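(* Let $\overline{\mathrm{Q}}$ be any imprecise probability tree. We have that $\overline{\mathrm{E}}_{\mathrm{meas}}(f\vert s)\leq\overline{\mathrm{E}}_{\mathrm{A}}(f\vert s)=\overline{\mathrm{E}}_{\mathrm{V}}(f\vert s)$ for all $f\in\overline{\mathbb{V}}$ and all $s\in\mathscr{X}^*$.
   Context: Conventions: $\mathbb{N}=\{1,2,\dots\}$, $\mathbb{N}_0=\mathbb{N}\cup\{0\}$, $\overline{\mathbb{R}}=\mathbb{R}\cup\{-\infty,+\infty\}$, with $+\infty-\infty=-\infty+\infty=+\infty$ and $0\cdot(+\infty)=0\cdot(-\infty)=0$; $\inf\emptyset=+\infty$. Inequalities between functions and limits of functions are pointwise. Setting: $\mathscr{X}$ is a finite non-empty set (state space). A situation is a finite string $x_{1:n}=(x_1,\dots,x_n)\in\mathscr{X}^n$, $n\in\mathbb{N}_0$ (the empty string is denoted $\Box$); $\mathscr{X}^*$ is the set of all situations. $\Omega=\mathscr{X}^{\mathbb{N}}$ is the set of paths $\omega=\omega_1\omega_2\cdots$, and $\omega^n=(\omega_1,\dots,\omega_n)$. For $s=x_{1:n}$, $\Gamma(s)=\{\omega\in\Omega:\omega^n=x_{1:n}\}$ (cylinder event) and $\mathbb{I}_s$ is the indicator of $\Gamma(s)$. $\overline{\mathbb{V}}$ is the set of all maps $\Omega\to\overline{\mathbb{R}}$ (global variables) and $\overline{\mathbb{V}}_{\mathrm b}$ the set of those that are bounded below by a real. A gamble is a bounded real-valued function. $f\in\overline{\mathbb{V}}$ is $n$-measurable if $f(\omega)$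 depends only on $\omega^n$; it is finitary if it is $n$-measurable for some $n\in\mathbb{N}_0$. $\mathbb{V}_{\mathrm{fin}}$ is the set of finitary gambles on $\Omega$. A sequence $\{f_n\}$ is uniformly bounded below if there is a real $c$ with $f_n\geq c$ for all $n$. $\mathscr{L}(\mathscr{X})$ is the set of all real-valued functions on $\mathscr{X}$; for $f\in\mathscr{L}(\mathscr{X})$, $f(X_{n+1})$ is the global variable $\omega\mapsto f(\omega_{n+1})$. Local models: an upper expectation $\overline{\mathrm{Q}}_s:\mathscr{L}(\mathscr{X})\to\overline{\mathbb{R}}$ is coherent if, for all $f,g\in\mathscr{L}(\mathscr{X})$ and real $\lambda\geq0$: $\overline{\mathrm{Q}}_s(f)\leq\sup f$; $\overline{\mathrm{Q}}_s(f+g)\leq\overline{\mathrm{Q}}_s(f)+\overline{\mathrm{Q}}_s(g)$; $\overline{\mathrm{Q}}_s(\lambda f)=\lambda\overline{\mathrm{Q}}_s(f)$ (it is then real-valued). An imprecise probability tree $\overline{\mathrm{Q}}$ assigns to each $s\in\mathscr{X}^*$ a coherent upper expectation $\overline{\mathrm{Q}}_s$ on $\mathscr{L}(\mathscr{X})$. Let $\mathbb{P}_s$ be the set of all probability mass functions $q$ on $\mathscr{X}$ with $\sum_{x\in\mathscr{X}}f(x)q(x)\leq\overline{\mathrm{Q}}_s(f)$ for all $f\in\mathscr{L}(\mathscr{X})$; it is known that $\overline{\mathrm{Q}}_s(f)=\max\{\sum_{x}f(x)q(x):q\in\mathbb{P}_s\}$. Axiomatic model: a global upper expectation is any map $\overline{\mathrm{E}}:\overline{\mathbb{V}}\times\mathscr{X}^*\to\overline{\mathbb{R}}$,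 $(f,s)\mapsto\overline{\mathrm{E}}(f\vert s)$; $\overline{\mathrm{E}}(f\vert X_{1:n})$ denotes the global variable $\omega\mapsto\overline{\mathrm{E}}(f\vert\omega^n)$. Axioms: P1: $\overline{\mathrm{E}}(f(X_{n+1})\vert x_{1:n})=\overline{\mathrm{Q}}_{x_{1:n}}(f)$ for all $f\in\mathscr{L}(\mathscr{X})$, $x_{1:n}\in\mathscr{X}^*$. P2: $\overline{\mathrm{E}}(f\vert s)=\overline{\mathrm{E}}(f\,\mathbb{I}_s\vert s)$ for all $f\in\mathbb{V}_{\mathrm{fin}}$, $s\in\mathscr{X}^*$. P3: $\overline{\mathrm{E}}(f\vert X_{1:n})\leq\overline{\mathrm{E}}(\overline{\mathrm{E}}(f\vert X_{1:n+1})\vert X_{1:n})$ for all $f\in\mathbb{V}_{\mathrm{fin}}$, $n\in\mathbb{N}_0$. P4: $f\leq g\Rightarrow\overline{\mathrm{E}}(f\vert s)\leq\overline{\mathrm{E}}(g\vert s)$ for all $f,g\in\overline{\mathbb{V}}$, $s\in\mathscr{X}^*$. P5: for any sequence $\{f_n\}_{n\in\mathbb{N}_0}$ of finitary gambles that is uniformly bounded below and any $s\in\mathscr{X}^*$, if $\lim_{n}f_n=f$ pointwise then $\limsup_{n}\overline{\mathrm{E}}(f_n\vert s)\geq\overline{\mathrm{E}}(f\vert s)$. $\overline{\mathrm{E}}_{\mathrm{A}}$ is the most conservative, i.e. pointwise largest, global upper expectation satisfying P1–P5 (it exists). Game-theoretic model: for each $s$, $\overline{\mathrm{Q}}{}_s^{\uparrow}$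 is the unique extension of $\overline{\mathrm{Q}}_s$ to all functions $f:\mathscr{X}\to\overline{\mathbb{R}}$ satisfying $\overline{\mathrm{Q}}{}_s^{\uparrow}(f)=\lim_{c\to+\infty}\overline{\mathrm{Q}}{}_s^{\uparrow}(\min\{f,c\})$ for all bounded below $f$, and $\overline{\mathrm{Q}}{}_s^{\uparrow}(f)=\lim_{c\to-\infty}\overline{\mathrm{Q}}{}_s^{\uparrow}(\max\{f,c\})$ for all $f$. A supermartingale is a map $\mathscr{M}:\mathscr{X}^*\to\overline{\mathbb{R}}$ with $\overline{\mathrm{Q}}{}_s^{\uparrow}(\mathscr{M}(s\,\cdot))\leq\mathscr{M}(s)$ for all $s\in\mathscr{X}^*$, where $\mathscr{M}(s\,\cdot)$ is the function $x\mapsto\mathscr{M}(sx)$ on $\mathscr{X}$. $\overline{\mathbb{M}}_{\mathrm b}$ is the set of supermartingales that are bounded below by a real constant. $\liminf\mathscr{M}$ is the global variable $\omega\mapsto\liminf_{n\to+\infty}\mathscr{M}(\omega^n)$, and $f\geq_s g$ means $f(\omega)\geq g(\omega)$ for all $\omega\in\Gamma(s)$. Then $\overline{\mathrm{E}}_{\mathrm V}(f\vert s)=\inf\{\mathscr{M}(s):\mathscr{M}\in\overline{\mathbb{M}}_{\mathrm b},\ \liminf\mathscr{M}\geq_s f\}$ for all $f\in\overline{\mathbb{V}}$, $s\in\mathscr{X}^*$. Measure-theoretic model: a precise probability tree $p$ assigns to each $s\in\mathscr{X}^*$ a probability mass function $p(\cdot\vert s)$ on $\mathscr{X}$; it is compatible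 with $\overline{\mathrm{Q}}$, written $p\sim\overline{\mathrm{Q}}$, if $p(\cdot\vert s)\in\mathbb{P}_s$ for all $s\in\mathscr{X}^*$. Let $\mathscr{F}$ be the $\sigma$-algebra on $\Omega$ generated by all cylinder events. For each $x_{1:n}\in\mathscr{X}^*$, $\mathrm{P}(\cdot\vert x_{1:n})$ is the unique $\sigma$-additive probability measure on $\mathscr{F}$ such that, for all $z_{1:m}\in\mathscr{X}^*$, $\mathrm{P}(\Gamma(z_{1:m})\vert x_{1:n})$ equals $\prod_{i=n}^{m-1}p(z_{i+1}\vert z_{1:i})$ if $n<m$ and $z_{1:n}=x_{1:n}$; $1$ if $n\geq m$ and $z_{1:m}=x_{1:m}$; and $0$ otherwise. For $\mathscr{F}$-measurable $g\in\overline{\mathbb{V}}_{\mathrm b}$, $\mathrm{E}_{\mathrm{meas},p}(g\vert s)=\int_\Omega g\,\mathrm{d}\mathrm{P}(\cdot\vert s)$ (Lebesgue integral, which exists). For all $f\in\overline{\mathbb{V}}$ and $s\in\mathscr{X}^*$, $\overline{\mathrm{E}}_{\mathrm{meas},p}(f\vert s)=\inf\{\mathrm{E}_{\mathrm{meas},p}(g\vert s):g\in\overline{\mathbb{V}}_{\mathrm b},\ g\text{ is }\mathscr{F}\text{-measurable and }g\geq f\}$, and the global measure-theoretic upper expectation is $\overline{\mathrm{E}}_{\mathrm{meas}}(f\vert s)=\sup\{\overline{\mathrm{E}}_{\mathrm{meas},p}(f\vert s):p\sim\overline{\mathrm{Q}}\}$. *)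

theory Defs
  imports "HOL-Probability.Probability"
begin

text \<open>
  The state space is a type of class \<open>finite\<close>. Paths are indexed from 0, so \<open>\<omega> i\<close> is the
  \<open>(i + 1)\<close>-th state of \<open>\<omega>\<close>. The type \<open>ereal\<close> follows the conventions
  \<open>\<infinity> - \<infinity> = - \<infinity> + \<infinity> = \<infinity>\<close>, \<open>0 * \<infinity> = 0 * (- \<infinity>) = 0\<close> and \<open>Inf {} = \<infinity>\<close>.
\<close>

type_synonym 'x situation = "'x list"
type_synonym 'x path = "nat \<Rightarrow> 'x"
type_synonym 'x global_variable = "'x path \<Rightarrow> ereal"
type_synonym 'x global_upper = "'x global_variable \<Rightarrow> 'x situation \<Rightarrow> ereal"
type_synonym 'x local_models = "'x situation \<Rightarrow> ('x \<Rightarrow> real) \<Rightarrow> ereal"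
type_synonym 'x precise_tree = "'x situation \<Rightarrow> 'x pmf"

definition prefix_of :: "'x path \<Rightarrow> nat \<Rightarrow> 'x situation" where
  "prefix_of \<omega> n = map \<omega> [0..<n]"

definition cylinder :: "'x situation \<Rightarrow> 'x path set" where
  "cylinder s = {\<omega>. prefix_of \<omega> (length s) = s}"

definition bounded_below :: "('a \<Rightarrow> ereal) \<Rightarrow> bool" where
  "bounded_below f \<longleftrightarrow> (\<exists>c::real. \<forall>a. ereal c \<le> f a)"

definition gamble :: "('a \<Rightarrow> ereal) \<Rightarrow> bool" where
  "gamble f \<longleftrightarrow> (\<exists>c::real. \<forall>a. \<bar>f a\<bar> \<le> ereal c)"

definition n_measurable :: "nat \<Rightarrow> 'x global_variable \<Rightarrow> bool" where
  "n_measurable n f \<longleftrightarrow> (\<forall>\<omega> \<omega>'. prefix_of \<omega> n = prefix_of \<omega>' n \<longrightarrow> f \<omega> = f \<omega>')"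

definition finitary :: "'x global_variable \<Rightarrow> bool" where
  "finitary f \<longleftrightarrow> (\<exists>n. n_measurable n f)"

definition finitary_gambles :: "'x global_variable set" where
  "finitary_gambles = {f. finitary f \<and> gamble f}"


section \<open>Local models\<close>

definition coherent :: "(('x::finite \<Rightarrow> real) \<Rightarrow> ereal) \<Rightarrow> bool" where
  "coherent R \<longleftrightarrow>
     (\<forall>f. R f \<le> (SUP x. ereal (f x))) \<and>
     (\<forall>f g. R (\<lambda>x. f x + g x) \<le> R f + R g) \<and>
     (\<forall>f. \<forall>c::real. 0 \<le> c \<longrightarrow> R (\<lambda>x. c * f x) = ereal c * R f)"

definition imprecise_probability_tree :: "'x::finite local_models \<Rightarrow> bool" where
  "imprecise_probability_tree Q \<longleftrightarrow> (\<forall>s. coherent (Q s))"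

definition credal_set :: "'x::finite local_models \<Rightarrow> 'x situation \<Rightarrow> 'x pmf set" where
  "credal_set Q s = {q. \<forall>f. ereal (\<Sum>x\<in>UNIV. f x * pmf q x) \<le> Q s f}"


section \<open>The axiomatic model\<close>

definition P1 :: "'x::finite local_models \<Rightarrow> 'x global_upper \<Rightarrow> bool" where
  "P1 Q E \<longleftrightarrow> (\<forall>f s. E (\<lambda>\<omega>. ereal (f (\<omega> (length s)))) s = Q s f)"

definition P2 :: "'x global_upper \<Rightarrow> bool" where
  "P2 E \<longleftrightarrow> (\<forall>f\<in>finitary_gambles. \<forall>s. E f s = E (\<lambda>\<omega>. f \<omega> * indicator (cylinder s) \<omega>) s)"

definition P3 :: "'x global_upper \<Rightarrow> bool" where
  "P3 E \<longleftrightarrow> (\<forall>f\<in>finitary_gambles. \<forall>n \<omega>.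
     E f (prefix_of \<omega> n) \<le> E (\<lambda>\<omega>'. E f (prefix_of \<omega>' (n + 1))) (prefix_of \<omega> n))"

definition P4 :: "'x global_upper \<Rightarrow> bool" where
  "P4 E \<longleftrightarrow> (\<forall>f g s. (\<forall>\<omega>. f \<omega> \<le> g \<omega>) \<longrightarrow> E f s \<le> E g s)"

definition P5 :: "'x global_upper \<Rightarrow> bool" where
  "P5 E \<longleftrightarrow> (\<forall>F f s.
     (\<forall>n::nat. F n \<in> finitary_gambles) \<and>
     (\<exists>c::real. \<forall>n \<omega>. ereal c \<le> F n \<omega>) \<and>
     (\<forall>\<omega>. (\<lambda>n. F n \<omega>) \<longlonglongrightarrow> f \<omega>) \<longrightarrow>
     E f s \<le> limsup (\<lambda>n. E (F n) s))"

text \<open>The order on \<open>'x global_upper\<close> is the pointwise one.\<close>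

definition E_A :: "'x::finite local_models \<Rightarrow> 'x global_upper" where
  "E_A Q = (GREATEST E. P1 Q E \<and> P2 E \<and> P3 E \<and> P4 E \<and> P5 E)"


section \<open>The game-theoretic model\<close>

definition local_extension :: "'x::finite local_models \<Rightarrow> 'x situation \<Rightarrow> ('x \<Rightarrow> ereal) \<Rightarrow> ereal" where
  "local_extension Q s = (THE R.
     (\<forall>f. R (\<lambda>x. ereal (f x)) = Q s f) \<and>
     (\<forall>f. bounded_below f \<longrightarrow>
        ((\<lambda>c::real. R (\<lambda>x. min (f x) (ereal c))) \<longlongrightarrow> R f) at_top) \<and>
     (\<forall>f. ((\<lambda>c::real. R (\<lambda>x. max (f x) (ereal c))) \<longlongrightarrow> R f) at_bot))"

definition supermartingale :: "'x::finite local_models \<Rightarrow> ('x situation \<Rightarrow> ereal) \<Rightarrow> bool" where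
  "supermartingale Q M \<longleftrightarrow> (\<forall>s. local_extension Q s (\<lambda>x. M (s @ [x])) \<le> M s)"

definition E_V :: "'x::finite local_models \<Rightarrow> 'x global_upper" where
  "E_V Q f s = Inf {M s | M. supermartingale Q M \<and> bounded_below M \<and>
     (\<forall>\<omega>\<in>cylinder s. f \<omega> \<le> liminf (\<lambda>n. M (prefix_of \<omega> n)))}"


section \<open>The measure-theoretic model\<close>

definition compatible :: "'x::finite precise_tree \<Rightarrow> 'x local_models \<Rightarrow> bool" where
  "compatible p Q \<longleftrightarrow> (\<forall>s. p s \<in> credal_set Q s)"

definition path_algebra :: "'x path measure" where
  "path_algebra = sigma UNIV (range cylinder)"

text \<open>Because of the indexing from 0, the state following \<open>take i z\<close> in \<open>z\<close> is \<open>z ! i\<close>.\<close>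

definition cylinder_prob :: "'x precise_tree \<Rightarrow> 'x situation \<Rightarrow> 'x situation \<Rightarrow> real" where
  "cylinder_prob p s z =
     (if length s < length z \<and> take (length s) z = s
      then \<Prod>i = length s..<length z. pmf (p (take i z)) (z ! i)
      else if length z \<le> length s \<and> take (length z) s = z then 1
      else 0)"

definition path_measure :: "'x precise_tree \<Rightarrow> 'x situation \<Rightarrow> 'x path measure" where
  "path_measure p s = (THE P. prob_space P \<and> sets P = sets path_algebra \<and>
     (\<forall>z. measure P (cylinder z) = cylinder_prob p s z))"

text \<open>
  The Lebesgue integral of an extended real function as the difference of the integrals of its
  positive and negative parts (\<open>e2ennreal\<close> sends negative numbers to 0). It is only used for
  functions that are bounded below, whose negative part has a finite integral.
\<close>

definition lebesgue_integral_ereal :: "'a measure \<Rightarrow> ('a \<Rightarrow> ereal) \<Rightarrow> ereal" where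
  "lebesgue_integral_ereal P g =
     enn2ereal (\<integral>\<^sup>+ a. e2ennreal (g a) \<partial>P) - enn2ereal (\<integral>\<^sup>+ a. e2ennreal (- g a) \<partial>P)"

definition E_meas_precise :: "'x precise_tree \<Rightarrow> 'x global_upper" where
  "E_meas_precise p f s = Inf {lebesgue_integral_ereal (path_measure p s) g | g.
     bounded_below g \<and> g \<in> borel_measurable path_algebra \<and> (\<forall>\<omega>. f \<omega> \<le> g \<omega>)}"

definition E_meas :: "'x::finite local_models \<Rightarrow> 'x global_upper" where
  "E_meas Q f s = Sup {E_meas_precise p f s | p. compatible p Q}"

end

theory Submission
  imports Defs "HOL-Library.Sublist"
begin

text \<open>
  Write \<open>E\<^sub>V\<close> for the game-theoretic upper expectation. It has to be shown that \<open>E\<^sub>V\<close> satisfies the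
  axioms, that it dominates every map that satisfies them, and that it dominates the
  measure-theoretic upper expectation.

  Only bounded below supermartingales occur in \<open>E\<^sub>V\<close>, so the extended local models matter only on
  bounded below functions. There they are suprema of \<open>Q s g\<close> over real \<open>g\<close> below the argument
  (\<open>local_extension_eq_upward_ext\<close>), and monotonicity, subadditivity and continuity along
  increasing sequences follow from coherence and the finiteness of the state space.

  The engine is an optional stopping principle (\<open>EV_optional_stopping\<close>): to bound \<open>E\<^sub>V(g | t)\<close> by
  \<open>M t\<close>, it is enough that on every path the supermartingale \<open>M\<close> either ends above \<open>g\<close> or at some
  time reaches \<open>E\<^sub>V(g | \<cdot>)\<close>, because one can then switch to a supermartingale that is nearly
  optimal for \<open>g\<close>. It turns upcrossing arguments into a contraction (\<open>null_upcrossings\<close>): if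
  \<open>\<beta>\<close> is the supremum over all situations of the upper probabilities of an event on whose paths
  nonnegative supermartingales keep rising from \<open>a\<close> to \<open>b\<close>, then playing one upcrossing shows \<open>\<beta> \<le> (a / b) * \<beta>\<close>, so
  \<open>\<beta> = 0\<close>. Two almost sure statements follow: Levy's zero-one law for \<open>E\<^sub>V(f | \<cdot>)\<close> (\<open>EV_levy\<close>)
  and Doob's convergence theorem (\<open>bsuper_converges\<close>).

  Among the axioms only the continuity axiom P5 is deep. It is a consequence of Fatou's lemma for
  \<open>E\<^sub>V\<close> (\<open>EV_fatou\<close>): with \<open>g k = (INF j\<ge>k. F j)\<close>, the process \<open>SUP k. E\<^sub>V(g k | \<cdot>)\<close> is a
  supermartingale, and by the zero-one law its lower limit dominates the limit of the \<open>F n\<close> outside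
  a null set.

  For maximality, let \<open>E\<close> satisfy the axioms. On finitary gambles \<open>E \<le> E\<^sub>V\<close> by backward recursion
  over the tree. For general \<open>f\<close> and a supermartingale \<open>M\<close> with lower limit above \<open>f\<close>, the
  truncated values of \<open>M\<close> at time \<open>n\<close> form a sequence of finitary gambles, but P5 requires it to
  converge on every path, whereas \<open>M\<close> converges only outside a null set. Adding an increasing
  sequence of small finitary gambles that tends to infinity on that null set repairs this at an
  arbitrarily small cost (\<open>finitary_approximation\<close>), and P5 then gives \<open>E(f | s) \<le> M s\<close>.

  For the measure-theoretic model, the path measure is the law of the path that one follows when a
  successor has been drawn independently at every situation. A bounded below supermartingale is
  an ordinary supermartingale for each compatible tree, so Fatou's lemma bounds the integral of its
  lower limit by its initial value.
\<close>

section \<open>Extending a coherent upper expectation to extended real functions\<close>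

text \<open>
  A coherent upper expectation is real-valued: subadditivity at \<open>f\<close> and \<open>- f\<close> excludes
  \<open>- \<infinity>\<close>. Working with the real functional \<open>r\<close> avoids extended arithmetic below.
\<close>

lemma coherent_real:
  fixes R :: "('x::finite \<Rightarrow> real) \<Rightarrow> ereal"
  assumes "coherent R"
  obtains r :: "('x \<Rightarrow> real) \<Rightarrow> real" where
    "\<And>f. R f = ereal (r f)"
    "\<And>f c. (\<And>x. f x \<le> c) \<Longrightarrow> r f \<le> c"
    "\<And>f g. r (\<lambda>x. f x + g x) \<le> r f + r g"
    "\<And>f c. 0 \<le> c \<Longrightarrow> r (\<lambda>x. c * f x) = c * r f"
    "\<And>f g. (\<And>x. f x \<le> g x) \<Longrightarrow> r f \<le> r g"
    "\<And>f c. (\<And>x. c \<le> f x) \<Longrightarrow> c \<le> r f"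
proof -
  have sup: "R f \<le> (SUP x. ereal (f x))" and add: "R (\<lambda>x. f x + g x) \<le> R f + R g"
    and mult: "0 \<le> c \<Longrightarrow> R (\<lambda>x. c * f x) = ereal c * R f" for f g and c :: real
    using assms unfolding coherent_def by auto
  have up: "R f \<le> ereal c" if "\<And>x. f x \<le> c" for f c
    by (rule order_trans[OF sup[of f]]) (use that in \<open>auto intro!: SUP_least\<close>)
  have fin: "R f < \<infinity>" for f
    using up[of f "Max (range f)"] by (auto simp: less_eq_ereal_def)
  have zero: "R (\<lambda>x. 0) = 0" using mult[of 0 "\<lambda>_. 0"] by (simp add: zero_ereal_def[symmetric])
  have bal: "0 \<le> R f + R (\<lambda>x. - f x)" for f
    using add[of f "\<lambda>x. - f x"] zero by simp
  have "\<bar>R f\<bar> \<noteq> \<infinity>" for f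
    using bal[of f] fin[of f] fin[of "\<lambda>x. - f x"]
    by (cases "R f"; cases "R (\<lambda>x. - f x)") auto
  then have r: "R f = ereal (real_of_ereal (R f))" for f by (simp add: ereal_real')
  define r where "r f = real_of_ereal (R f)" for f
  have r: "R f = ereal (r f)" for f using r r_def by simp
  have 1: "r f \<le> c" if "\<And>x. f x \<le> c" for f c using up[OF that] r by auto
  have 2: "r (\<lambda>x. f x + g x) \<le> r f + r g" for f g using add[of f g] r by auto
  have 3: "r (\<lambda>x. c * f x) = c * r f" if "0 \<le> c" for c f using mult[OF that, of f] r by auto
  have 4: "r f \<le> r g" if "\<And>x. f x \<le> g x" for f g
    using 2[of g "\<lambda>x. f x - g x"] 1[of "\<lambda>x. f x - g x" 0] that by auto
  have 5: "c \<le> r f" if "\<And>x. c \<le> f x" for f c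
    using bal[of f] r 1[of "\<lambda>x. - f x" "- c"] that by auto
  show thesis using that r 1 2 3 4 5 by blast
qed

text \<open>
  On bounded below functions this is the local extension. It is the inner approximation by real
  functions, which makes monotonicity a triviality and needs no double limit.
\<close>

definition upward_ext :: "(('x::finite \<Rightarrow> real) \<Rightarrow> ereal) \<Rightarrow> ('x \<Rightarrow> ereal) \<Rightarrow> ereal" where
  "upward_ext R f = (SUP g\<in>{g. \<forall>x. ereal (g x) \<le> f x}. R g)"

lemma upward_ext_upper: "(\<And>x. ereal (g x) \<le> f x) \<Longrightarrow> R g \<le> upward_ext R f"
  unfolding upward_ext_def by (rule SUP_upper) simp

lemma upward_ext_least: "(\<And>g. (\<And>x. ereal (g x) \<le> f x) \<Longrightarrow> R g \<le> y) \<Longrightarrow> upward_ext R f \<le> y"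
  unfolding upward_ext_def by (rule SUP_least) simp

lemma upward_ext_mono: "(\<And>x. f x \<le> g x) \<Longrightarrow> upward_ext R f \<le> upward_ext R g"
  by (intro upward_ext_least upward_ext_upper) (blast intro: order_trans)

lemma coherent_mono:
  assumes "coherent R" "\<And>x. f x \<le> g x" shows "R f \<le> R g"
  using assms by (metis coherent_real ereal_less_eq(3))

lemma upward_ext_real: assumes "coherent R" shows "upward_ext R (\<lambda>x. ereal (f x)) = R f"
  by (intro antisym upward_ext_least upward_ext_upper coherent_mono[OF assms]) auto

lemma upward_ext_le: assumes "coherent R" "\<And>x. f x \<le> y" shows "upward_ext R f \<le> y"
proof (rule upward_ext_least)
  fix g assume g: "\<And>x. ereal (g x) \<le> f x"
  then have gy: "ereal (g x) \<le> y" for x using assms(2) order_trans by blast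
  obtain r where r: "\<And>f. R f = ereal (r f)" "\<And>f c. (\<And>x. f x \<le> c) \<Longrightarrow> r f \<le> c"
    using coherent_real[OF assms(1)] by metis
  show "R g \<le> y" using gy r by (cases y) auto
qed

lemma upward_ext_ge: assumes "coherent R" "\<And>x. ereal c \<le> f x" shows "ereal c \<le> upward_ext R f"
proof -
  obtain r where r: "\<And>f. R f = ereal (r f)" "\<And>f c. (\<And>x. c \<le> f x) \<Longrightarrow> c \<le> r f"
    using coherent_real[OF assms(1)] by metis
  have "ereal c \<le> R (\<lambda>_. c)" using r by simp
  also have "\<dots> \<le> upward_ext R f" using assms(2) by (rule upward_ext_upper)
  finally show ?thesis .
qed

text \<open>
  Since an upper expectation is at least the minimum, a supermartingale can never increase towards
  all successors at once. This provides the paths in \<open>bsuper_path\<close>.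
\<close>

lemma upward_ext_attains: assumes "coherent R" shows "\<exists>x. f x \<le> upward_ext R f"
proof -
  have "Min (range f) \<in> range f" by (intro Min_in) auto
  then obtain x0 where x0: "f x0 = Min (range f)" unfolding image_iff by force
  have le: "f x0 \<le> f x" for x unfolding x0 by simp
  have "y \<le> upward_ext R f" if "y < f x0" for y
  proof (cases y)
    case (real c)
    then show ?thesis using that le by (auto intro!: upward_ext_ge[OF assms] intro: less_imp_le less_le_trans)
  qed (use that in auto)
  then have "f x0 \<le> upward_ext R f" by (rule dense_le)
  then show ?thesis ..
qed

text \<open>
  A real \<open>h\<close> below \<open>f + g\<close> is split into real functions below \<open>f\<close> and \<open>g\<close>; the common lower bound
  keeps the other summand harmless where one of them is infinite.
\<close>

lemma upward_ext_add:
  fixes f g :: "'x::finite \<Rightarrow> ereal"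
  assumes "coherent R" "\<And>x. ereal c \<le> f x" "\<And>x. ereal c \<le> g x"
  shows "upward_ext R (\<lambda>x. f x + g x) \<le> upward_ext R f + upward_ext R g"
proof (rule upward_ext_least)
  fix h assume h: "\<And>x. ereal (h x) \<le> f x + g x"
  obtain r where r: "\<And>f. R f = ereal (r f)" "\<And>f g. r (\<lambda>x. f x + g x) \<le> r f + r g"
    "\<And>f g. (\<And>x. f x \<le> g x) \<Longrightarrow> r f \<le> r g"
    using coherent_real[OF assms(1)] by metis
  \<comment> \<open>Where \<open>f\<close> is infinite, \<open>\<bar>h\<bar> + \<bar>c\<bar>\<close> compensates the summand \<open>g \<ge> c\<close>.\<close>
  define f' where "f' x = (if f x = \<infinity> then \<bar>h x\<bar> + \<bar>c\<bar> else real_of_ereal (f x))" for x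
  define g' where "g' x = (if g x = \<infinity> then \<bar>h x\<bar> + \<bar>c\<bar> else real_of_ereal (g x))" for x
  have f': "ereal (f' x) \<le> f x" and g': "ereal (g' x) \<le> g x" for x
    using assms(2,3)[of x] unfolding f'_def g'_def by (cases "f x"; cases "g x"; simp)+
  have "h x \<le> f' x + g' x" for x
    using h[of x] assms(2,3)[of x] unfolding f'_def g'_def
    by (cases "f x"; cases "g x") auto
  then have "r h \<le> r f' + r g'" using r(2)[of f' g'] r(3)[of h "\<lambda>x. f' x + g' x"] by force
  then have "R h \<le> R f' + R g'" by (simp add: r(1))
  also have "\<dots> \<le> upward_ext R f + upward_ext R g" using f' g' by (intro add_mono upward_ext_upper)
  finally show "R h \<le> upward_ext R f + upward_ext R g" .
qed

lemma upward_ext_cmult: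
  assumes "coherent R" "0 \<le> c"
  shows "upward_ext R (\<lambda>x. ereal c * f x) \<le> ereal c * upward_ext R f"
proof (cases "c = 0")
  case True
  then show ?thesis using upward_ext_le[OF assms(1), of "\<lambda>_. 0" 0] by (simp add: zero_ereal_def[symmetric])
next
  case False
  then have c: "0 < c" using assms(2) by simp
  show ?thesis
  proof (rule upward_ext_least)
    fix g assume g: "\<And>x. ereal (g x) \<le> ereal c * f x"
    have "ereal (g x / c) \<le> f x" for x using g[of x] c by (cases "f x") (auto simp: field_simps)
    then have "R (\<lambda>x. g x / c) \<le> upward_ext R f" by (rule upward_ext_upper)
    then have "ereal c * R (\<lambda>x. g x / c) \<le> ereal c * upward_ext R f"
      using c by (intro ereal_mult_left_mono) auto
    moreover have "R (\<lambda>x. c * (g x / c)) = ereal c * R (\<lambda>x. g x / c)"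
      using assms unfolding coherent_def by metis
    ultimately show "R g \<le> ereal c * upward_ext R f" using c by simp
  qed
qed

text \<open>
  On a finite space, a real \<open>h\<close> below the supremum of an increasing sequence is, up to \<open>e\<close>, below
  a single member of the sequence.
\<close>

lemma upward_ext_SUP:
  fixes F :: "nat \<Rightarrow> 'x::finite \<Rightarrow> ereal"
  assumes "coherent R" "\<And>x. incseq (\<lambda>k. F k x)"
  shows "upward_ext R (\<lambda>x. SUP k. F k x) \<le> (SUP k. upward_ext R (F k))"
proof (rule upward_ext_least)
  fix h assume h: "\<And>x. ereal (h x) \<le> (SUP k. F k x)"
  obtain r where r: "\<And>f. R f = ereal (r f)" "\<And>f g. r (\<lambda>x. f x + g x) \<le> r f + r g"
    "\<And>f c. (\<And>x. f x \<le> c) \<Longrightarrow> r f \<le> c"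
    using coherent_real[OF assms(1)] by metis
  show "R h \<le> (SUP k. upward_ext R (F k))"
  proof (rule ereal_le_epsilon2)
    fix e :: real assume e: "0 < e"
    have "\<exists>k. ereal (h x - e) \<le> F k x" for x
    proof -
      have "ereal (h x - e) < ereal (h x)" using e by simp
      then have "ereal (h x - e) < (SUP k. F k x)" using h[of x] by (rule less_le_trans)
      then show ?thesis unfolding less_SUP_iff using less_imp_le by blast
    qed
    then obtain k where k: "\<And>x. ereal (h x - e) \<le> F (k x) x" by metis
    define K where "K = Max (range k)"
    have "ereal (h x - e) \<le> F K x" for x
      using k[of x] incseqD[OF assms(2)[of x], of "k x" K] unfolding K_def by (meson Max_ge finite finite_imageI order_trans rangeI)
    then have "R (\<lambda>x. h x - e) \<le> upward_ext R (F K)" by (rule upward_ext_upper)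
    also have "\<dots> \<le> (SUP k. upward_ext R (F k))" by (rule SUP_upper) simp
    finally have 1: "R (\<lambda>x. h x - e) \<le> (SUP k. upward_ext R (F k))" .
    have "r h \<le> r (\<lambda>x. h x - e) + e" using r(2)[of "\<lambda>x. h x - e" "\<lambda>_. e"] r(3)[of "\<lambda>_. e" e] by simp
    then have "R h \<le> R (\<lambda>x. h x - e) + ereal e" by (simp add: r(1))
    also have "\<dots> \<le> (SUP k. upward_ext R (F k)) + ereal e" using 1 by (rule add_right_mono)
    finally show "R h \<le> (SUP k. upward_ext R (F k)) + ereal e" .
  qed
qed

text \<open>
  The first condition and the continuity from below determine the extension on bounded below
  functions, and the continuity from above determines it everywhere. The witness \<open>X\<close> takes the
  infimum over all lower truncations of the inner approximation.
\<close>

lemma local_extension_eq_upward_ext: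
  fixes Q :: "'x::finite local_models"
  assumes Q_coherent: "coherent (Q s)" and bd: "bounded_below f"
  shows "local_extension Q s f = upward_ext (Q s) f"
proof -
  let ?P = "\<lambda>R. (\<forall>f. R (\<lambda>x. ereal (f x)) = Q s f) \<and>
     (\<forall>f. bounded_below f \<longrightarrow>
        ((\<lambda>c::real. R (\<lambda>x. min (f x) (ereal c))) \<longlongrightarrow> R f) at_top) \<and>
     (\<forall>f. ((\<lambda>c::real. R (\<lambda>x. max (f x) (ereal c))) \<longlongrightarrow> R f) at_bot)"
  define X where "X f = (INF c::real. upward_ext (Q s) (\<lambda>x. max (f x) (ereal c)))" for f
  have X: "X f = upward_ext (Q s) f" if "bounded_below f" for f
  proof -
    from that obtain c :: real where c: "\<And>x. ereal c \<le> f x" unfolding bounded_below_def by auto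
    have "X f \<le> upward_ext (Q s) (\<lambda>x. max (f x) (ereal c))" unfolding X_def by (rule INF_lower) simp
    also have "\<dots> = upward_ext (Q s) f" using c by (simp add: max_absorb1)
    finally show ?thesis unfolding X_def by (intro antisym INF_greatest upward_ext_mono) auto
  qed
  have real: "X (\<lambda>x. ereal (g x)) = Q s g" for g
  proof -
    have "bounded_below (\<lambda>x. ereal (g x))" unfolding bounded_below_def
      by (rule exI[of _ "Min (range g)"]) simp
    then show ?thesis using X upward_ext_real[OF Q_coherent] by simp
  qed
  have top: "((\<lambda>c::real. X (\<lambda>x. min (f x) (ereal c))) \<longlongrightarrow> X f) at_top" if bd: "bounded_below f" for f
  proof (rule order_tendstoI)
    from bd obtain b :: real where b: "\<And>x. ereal b \<le> f x" unfolding bounded_below_def by auto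
    have Xc: "X (\<lambda>x. min (f x) (ereal c)) = upward_ext (Q s) (\<lambda>x. min (f x) (ereal c))" for c
    proof (rule X)
      show "bounded_below (\<lambda>x. min (f x) (ereal c))" unfolding bounded_below_def
        using b by (intro exI[of _ "min b c"]) (metis ereal_min min.mono order_refl)
    qed
    show "\<forall>\<^sub>F c in at_top. a < X (\<lambda>x. min (f x) (ereal c))" if a: "a < X f" for a
    proof -
      obtain g where g: "\<And>x. ereal (g x) \<le> f x" "a < Q s g"
        using a unfolding X[OF bd] upward_ext_def less_SUP_iff by blast
      have "a < X (\<lambda>x. min (f x) (ereal c))" if "c \<ge> Max (range g)" for c
      proof -
        have "g x \<le> c" for x using that by (meson Max_ge finite finite_imageI order_trans rangeI)
        then have "Q s g \<le> upward_ext (Q s) (\<lambda>x. min (f x) (ereal c))" using g by (intro upward_ext_upper) auto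
        then show ?thesis using g(2) Xc by simp
      qed
      then show ?thesis unfolding eventually_at_top_linorder by blast
    qed
    show "\<forall>\<^sub>F c in at_top. X (\<lambda>x. min (f x) (ereal c)) < a" if "X f < a" for a
    proof (rule always_eventually, rule allI)
      fix c
      have "X (\<lambda>x. min (f x) (ereal c)) \<le> X f" unfolding Xc X[OF bd] by (rule upward_ext_mono) simp
      then show "X (\<lambda>x. min (f x) (ereal c)) < a" using that by simp
    qed
  qed
  have bot: "((\<lambda>c::real. X (\<lambda>x. max (f x) (ereal c))) \<longlongrightarrow> X f) at_bot" for f
  proof (rule order_tendstoI)
    have Xc: "X (\<lambda>x. max (f x) (ereal c)) = upward_ext (Q s) (\<lambda>x. max (f x) (ereal c))" for c
      by (rule X) (auto simp: bounded_below_def intro!: exI[of _ c])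
    show "\<forall>\<^sub>F c in at_bot. X (\<lambda>x. max (f x) (ereal c)) < a" if a: "X f < a" for a
    proof -
      obtain c where c: "upward_ext (Q s) (\<lambda>x. max (f x) (ereal c)) < a"
        using a unfolding X_def INF_less_iff by auto
      have "X (\<lambda>x. max (f x) (ereal d)) < a" if "d \<le> c" for d
        unfolding Xc by (rule le_less_trans[OF upward_ext_mono c]) (use that in \<open>simp add: max.coboundedI2\<close>)
      then show ?thesis unfolding eventually_at_bot_linorder by blast
    qed
    show "\<forall>\<^sub>F c in at_bot. a < X (\<lambda>x. max (f x) (ereal c))" if "a < X f" for a
    proof (rule always_eventually, rule allI)
      fix c
      have "X f \<le> X (\<lambda>x. max (f x) (ereal c))" unfolding Xc unfolding X_def by (rule INF_lower) simp
      then show "a < X (\<lambda>x. max (f x) (ereal c))" using that by simp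
    qed
  qed
  have "local_extension Q s = X"
    unfolding local_extension_def
  proof (rule the_equality)
    show "?P X" using real top bot by blast
    fix R assume R: "?P R"
    have eq: "R f = X f" if bd: "bounded_below f" for f
    proof (rule tendsto_unique[OF _ _ top[OF bd]])
      from bd obtain b :: real where b: "\<And>x. ereal b \<le> f x" unfolding bounded_below_def by auto
      have "R (\<lambda>x. min (f x) (ereal c)) = X (\<lambda>x. min (f x) (ereal c))" for c
      proof -
        have "(\<lambda>x. min (f x) (ereal c)) = (\<lambda>x. ereal (real_of_ereal (min (f x) (ereal c))))"
        proof
          fix x show "min (f x) (ereal c) = ereal (real_of_ereal (min (f x) (ereal c)))"
            using b[of x] by (cases "f x") (auto simp: min_def)
        qed
        then show ?thesis using R real by metis
      qed
      moreover have "((\<lambda>c. R (\<lambda>x. min (f x) (ereal c))) \<longlongrightarrow> R f) at_top" using R bd by blast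
      ultimately show "((\<lambda>c. X (\<lambda>x. min (f x) (ereal c))) \<longlongrightarrow> R f) at_top" by simp
    qed simp
    show "R = X"
    proof
      fix f
      have "R (\<lambda>x. max (f x) (ereal c)) = X (\<lambda>x. max (f x) (ereal c))" for c
        by (rule eq) (auto simp: bounded_below_def intro!: exI[of _ c])
      moreover have "((\<lambda>c. R (\<lambda>x. max (f x) (ereal c))) \<longlongrightarrow> R f) at_bot" using R by blast
      ultimately have "((\<lambda>c. X (\<lambda>x. max (f x) (ereal c))) \<longlongrightarrow> R f) at_bot" by simp
      then show "R f = X f" by (rule tendsto_unique[OF _ _ bot, rotated]) simp
    qed
  qed
  then show ?thesis using X[OF bd] by simp
qed

section \<open>Situations, paths and supermartingales\<close>

lemma length_prefix_of [simp]: "length (prefix_of \<omega> n) = n"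
  by (simp add: prefix_of_def)

lemma prefix_of_Suc: "prefix_of \<omega> (Suc n) = prefix_of \<omega> n @ [\<omega> n]"
  by (simp add: prefix_of_def)

lemma prefix_of_nth [simp]: "i < n \<Longrightarrow> prefix_of \<omega> n ! i = \<omega> i"
  by (simp add: prefix_of_def)

lemma take_prefix_of: "take k (prefix_of \<omega> n) = prefix_of \<omega> (min k n)"
  by (rule nth_equalityI) auto

lemma prefix_iff_take: "prefix s t \<longleftrightarrow> take (length s) t = s"
  by (metis append_eq_conv_conj prefix_def take_is_prefix)

lemma prefix_prefix_of_iff: "prefix s (prefix_of \<omega> n) \<longleftrightarrow> length s \<le> n \<and> \<omega> \<in> cylinder s"
  unfolding prefix_iff_take take_prefix_of cylinder_def
  by (cases "length s \<le> n") (auto dest: arg_cong[of _ _ length])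

lemma mem_cylinder_iff: "\<omega> \<in> cylinder s \<longleftrightarrow> (\<forall>i<length s. \<omega> i = s ! i)"
  unfolding cylinder_def by (auto simp: list_eq_iff_nth_eq)

lemma mem_cylinder_prefix_of [simp]: "\<omega> \<in> cylinder (prefix_of \<omega> n)"
  by (simp add: cylinder_def)

lemma cylinder_antimono: "prefix s t \<Longrightarrow> cylinder t \<subseteq> cylinder s"
  unfolding cylinder_def prefix_iff_take
  by auto (metis length_take min.absorb_iff2 min.commute take_prefix_of)

lemma prefix_of_mem_cylinder: "\<omega> \<in> cylinder s \<Longrightarrow> prefix_of \<omega> (length s) = s"
  by (simp add: cylinder_def)

text \<open>
  A strategy that picks a successor at every situation determines one path. This path serves
  twice: with a successor along which a supermartingale does not increase, and with random
  successors to realize the path measure.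
\<close>

primrec follow_prefix :: "('x situation \<Rightarrow> 'x) \<Rightarrow> nat \<Rightarrow> 'x situation" where
  "follow_prefix X 0 = []"
| "follow_prefix X (Suc n) = follow_prefix X n @ [X (follow_prefix X n)]"

definition follow :: "('x situation \<Rightarrow> 'x) \<Rightarrow> 'x path" where
  "follow X n = X (follow_prefix X n)"

lemma prefix_of_follow: "prefix_of (follow X) n = follow_prefix X n"
  by (induction n) (auto simp: prefix_of_Suc follow_def, simp add: prefix_of_def)

lemma follow_eq: "follow X n = X (prefix_of (follow X) n)"
  by (simp add: prefix_of_follow follow_def)

lemma follow_mem_cylinder_iff: "follow X \<in> cylinder z \<longleftrightarrow> (\<forall>i<length z. X (take i z) = z ! i)"
proof -
  have "follow X \<in> cylinder (take n z) \<longleftrightarrow> (\<forall>i<n. X (take i z) = z ! i)" if "n \<le> length z" for n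
    using that
  proof (induction n)
    case 0
    then show ?case by (simp add: mem_cylinder_iff)
  next
    case (Suc n)
    have "follow X \<in> cylinder (take (Suc n) z) \<longleftrightarrow> follow X \<in> cylinder (take n z) \<and> follow X n = z ! n"
      using Suc.prems by (auto simp: mem_cylinder_iff less_Suc_eq)
    also have "\<dots> \<longleftrightarrow> follow X \<in> cylinder (take n z) \<and> X (take n z) = z ! n"
      using Suc.prems by (auto simp: follow_eq dest: prefix_of_mem_cylinder)
    finally show ?case using Suc by (auto simp: less_Suc_eq)
  qed
  from this[of "length z"] show ?thesis by simp
qed

lemma cylinder_nonempty: "cylinder s \<noteq> {}"
proof -
  have "(\<lambda>i. s ! i) \<in> cylinder s" by (simp add: mem_cylinder_iff)
  then show ?thesis by blast
qed

text \<open>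
  Bounded below sequences exclude the combination \<open>\<infinity> - \<infinity>\<close>, for which the superadditivity of lower
  limits would fail.
\<close>

lemma le_liminf_add:
  fixes a b :: ereal
  assumes "\<And>n. ereal c \<le> u n" "\<And>n. ereal c \<le> v n" "a \<le> liminf u" "b \<le> liminf v"
  shows "a + b \<le> liminf (\<lambda>n. u n + v n)"
proof -
  have "ereal c \<le> liminf u" "ereal c \<le> liminf v"
    using assms by (auto intro!: Liminf_bounded)
  then have "liminf u + liminf v \<le> liminf (\<lambda>n. u n + v n)"
    by (intro ereal_liminf_add_mono) auto
  then show ?thesis using add_mono[OF assms(3,4)] by (rule order_trans[rotated])
qed

lemma liminf_less_frequently:
  fixes x :: "nat \<Rightarrow> ereal"
  assumes "liminf x < a" shows "\<exists>n\<ge>m. x n < a"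
proof (rule ccontr)
  assume "\<not> ?thesis"
  then have "a \<le> liminf x" by (intro Liminf_bounded) (auto simp: eventually_sequentially not_less)
  then show False using assms by simp
qed

lemma limsup_greater_frequently:
  fixes x :: "nat \<Rightarrow> ereal"
  assumes "a < limsup x" shows "\<exists>n\<ge>m. a < x n"
proof (rule ccontr)
  assume "\<not> ?thesis"
  then have "limsup x \<le> a" by (intro Limsup_bounded) (auto simp: eventually_sequentially not_less)
  then show False using assms by simp
qed

lemma gamble_bounds:
  assumes "gamble f" obtains c where "\<And>\<omega>. ereal (- c) \<le> f \<omega>" "\<And>\<omega>. f \<omega> \<le> ereal c"
proof -
  obtain c where c: "\<And>\<omega>. \<bar>f \<omega>\<bar> \<le> ereal c" using assms unfolding gamble_def by blast
  have "ereal (- c) \<le> f \<omega>" "f \<omega> \<le> ereal c" for \<omega> using c[of \<omega>] by (cases "f \<omega>"; auto)+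
  then show thesis by (rule that)
qed

lemma n_measurable_mono:
  fixes f :: "'a global_variable"
  shows "n_measurable m f \<Longrightarrow> m \<le> n \<Longrightarrow> n_measurable n f"
  unfolding n_measurable_def
proof (intro allI impI)
  fix \<omega> \<omega>' :: "'a path"
  assume f: "\<forall>\<omega> \<omega>'. prefix_of \<omega> m = prefix_of \<omega>' m \<longrightarrow> f \<omega> = f \<omega>'" and "m \<le> n"
    and eq: "prefix_of \<omega> n = prefix_of \<omega>' n"
  have "prefix_of \<omega> m = prefix_of \<omega>' m"
    using arg_cong[OF eq, of "take m"] \<open>m \<le> n\<close> by (simp only: take_prefix_of min_absorb1)
  then show "f \<omega> = f \<omega>'" using f by blast
qed

lemma n_measurable_cylinder:
  assumes "n_measurable n f" "n \<le> length s" "\<omega> \<in> cylinder s" "\<omega>' \<in> cylinder s"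
  shows "f \<omega> = f \<omega>'"
proof -
  have "n_measurable (length s) f" using assms(1,2) by (rule n_measurable_mono)
  moreover have "prefix_of \<omega> (length s) = prefix_of \<omega>' (length s)"
    using assms(3,4) by (simp only: prefix_of_mem_cylinder)
  ultimately show ?thesis unfolding n_measurable_def by blast
qed

lemma finitary_gambleI:
  assumes "n_measurable n f" "\<And>\<omega>. ereal (- c) \<le> f \<omega>" "\<And>\<omega>. f \<omega> \<le> ereal c"
  shows "f \<in> finitary_gambles"
proof -
  have "\<bar>f \<omega>\<bar> \<le> ereal c" for \<omega> using assms(2,3)[of \<omega>] by (cases "f \<omega>") auto
  then show ?thesis using assms(1) unfolding finitary_gambles_def finitary_def gamble_def by blast
qed

locale imprecise_tree =
  fixes Q :: "'x::finite local_models"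
  assumes tree: "imprecise_probability_tree Q"
begin

lemma Q_coherent: "coherent (Q s)"
  using tree by (simp add: imprecise_probability_tree_def)

text \<open>
  The inner approximation replaces \<open>local_extension\<close>, so that the inequality unfolds to one about
  real functions below the successor values. On bounded below processes both agree (\<open>bsuper_iff\<close>).
\<close>

definition bsuper :: "('x situation \<Rightarrow> ereal) \<Rightarrow> bool" where
  "bsuper M \<longleftrightarrow> bounded_below M \<and> (\<forall>s. upward_ext (Q s) (\<lambda>x. M (s @ [x])) \<le> M s)"

lemma bsuper_iff: "bsuper M \<longleftrightarrow> supermartingale Q M \<and> bounded_below M"
proof -
  have "local_extension Q s (\<lambda>x. M (s @ [x])) = upward_ext (Q s) (\<lambda>x. M (s @ [x]))" if "bounded_below M" for s
    by (rule local_extension_eq_upward_ext[OF Q_coherent]) (use that in \<open>auto simp: bounded_below_def\<close>)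
  then show ?thesis unfolding bsuper_def supermartingale_def by auto
qed

lemma bsuperD: "bsuper M \<Longrightarrow> upward_ext (Q s) (\<lambda>x. M (s @ [x])) \<le> M s"
  by (simp add: bsuper_def)

lemma bsuperI:
  "(\<And>s. ereal c \<le> M s) \<Longrightarrow> (\<And>s. upward_ext (Q s) (\<lambda>x. M (s @ [x])) \<le> M s) \<Longrightarrow> bsuper M"
  unfolding bsuper_def bounded_below_def by auto

lemma bsuper_bound: assumes "bsuper M" obtains c where "\<And>s. ereal c \<le> M s"
  using assms unfolding bsuper_def bounded_below_def by auto

lemma bsuper_const: "bsuper (\<lambda>_. ereal c)"
  by (rule bsuperI[of c]) (auto intro: upward_ext_le[OF Q_coherent])

lemma bsuper_common_bound:
  assumes "bsuper M" "bsuper N"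
  obtains c where "\<And>s. ereal c \<le> M s" "\<And>s. ereal c \<le> N s"
proof -
  obtain c d where c: "\<And>s. ereal c \<le> M s" and d: "\<And>s. ereal d \<le> N s"
    using bsuper_bound assms by metis
  have "ereal (min c d) \<le> M s" "ereal (min c d) \<le> N s" for s
    using c[of s] d[of s] order_trans[of "ereal (min c d)" "ereal c"]
      order_trans[of "ereal (min c d)" "ereal d"] by (auto simp del: ereal_min)
  then show thesis by (rule that)
qed

lemma bsuper_add:
  assumes M: "bsuper M" and N: "bsuper N"
  shows "bsuper (\<lambda>s. M s + N s)"
proof -
  from bsuper_common_bound[OF assms] obtain c
    where c: "\<And>s. ereal c \<le> M s" "\<And>s. ereal c \<le> N s" by metis
  show ?thesis
  proof (rule bsuperI)
    show "ereal (c + c) \<le> M s + N s" for s using add_mono[OF c(1) c(2)] by simp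
    fix s
    have "upward_ext (Q s) (\<lambda>x. M (s @ [x]) + N (s @ [x]))
        \<le> upward_ext (Q s) (\<lambda>x. M (s @ [x])) + upward_ext (Q s) (\<lambda>x. N (s @ [x]))"
      by (rule upward_ext_add[OF Q_coherent c])
    also have "\<dots> \<le> M s + N s" using M N by (intro add_mono bsuperD)
    finally show "upward_ext (Q s) (\<lambda>x. M (s @ [x]) + N (s @ [x])) \<le> M s + N s" .
  qed
qed

lemma bsuper_cmult:
  assumes M: "bsuper M" and "0 \<le> a"
  shows "bsuper (\<lambda>s. ereal a * M s)"
proof -
  obtain c where c: "\<And>s. ereal c \<le> M s" using bsuper_bound M by metis
  show ?thesis
  proof (rule bsuperI)
    show "ereal (a * c) \<le> ereal a * M s" for s
      using ereal_mult_left_mono[OF c[of s], of "ereal a"] assms(2) by simp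
    fix s
    have "upward_ext (Q s) (\<lambda>x. ereal a * M (s @ [x])) \<le> ereal a * upward_ext (Q s) (\<lambda>x. M (s @ [x]))"
      by (rule upward_ext_cmult[OF Q_coherent assms(2)])
    also have "\<dots> \<le> ereal a * M s" using bsuperD[OF M] assms(2) by (intro ereal_mult_left_mono) auto
    finally show "upward_ext (Q s) (\<lambda>x. ereal a * M (s @ [x])) \<le> ereal a * M s" .
  qed
qed

lemma bsuper_SUP:
  fixes M :: "nat \<Rightarrow> 'x situation \<Rightarrow> ereal"
  assumes M: "\<And>k. bsuper (M k)" and inc: "\<And>s. incseq (\<lambda>k. M k s)"
  shows "bsuper (\<lambda>s. SUP k. M k s)"
proof -
  obtain c where c: "\<And>s. ereal c \<le> M 0 s" using bsuper_bound M by metis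
  show ?thesis
  proof (rule bsuperI)
    show "ereal c \<le> (SUP k. M k s)" for s by (rule SUP_upper2[of 0]) (auto simp: c)
    fix s
    have "upward_ext (Q s) (\<lambda>x. SUP k. M k (s @ [x])) \<le> (SUP k. upward_ext (Q s) (\<lambda>x. M k (s @ [x])))"
      by (rule upward_ext_SUP[OF Q_coherent inc])
    also have "\<dots> \<le> (SUP k. M k s)" using M by (intro SUP_mono) (auto intro: bsuperD)
    finally show "upward_ext (Q s) (\<lambda>x. SUP k. M k (s @ [x])) \<le> (SUP k. M k s)" .
  qed
qed

lemma bsuper_suminf:
  fixes M :: "nat \<Rightarrow> 'x situation \<Rightarrow> ereal"
  assumes M: "\<And>k. bsuper (M k)" and pos: "\<And>k s. 0 \<le> M k s"
  shows "bsuper (\<lambda>s. \<Sum>k. M k s)"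
proof -
  have "bsuper (\<lambda>s. \<Sum>k<n. M k s)" for n
  proof (induction n)
    case 0
    then show ?case using bsuper_const[of 0] by (simp add: zero_ereal_def)
  next
    case (Suc n)
    then show ?case using bsuper_add[OF Suc M[of n]] by simp
  qed
  moreover have "incseq (\<lambda>n. \<Sum>k<n. M k s)" for s
    by (intro incseq_SucI) (simp add: pos add_increasing2)
  ultimately show ?thesis
    using bsuper_SUP[of "\<lambda>n s. \<Sum>k<n. M k s"] pos by (simp add: suminf_ereal_eq_SUP)
qed

text \<open>
  Situations outside the subtree of \<open>s\<close> do not matter for an expectation conditional on \<open>s\<close>. The
  value \<open>\<infinity>\<close> there makes lower bounds that hold in the subtree global.
\<close>

lemma bsuper_restrict:
  assumes "bsuper M"
  shows "bsuper (\<lambda>t. if prefix s t then M t else \<infinity>)"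
proof -
  obtain c where c: "\<And>s. ereal c \<le> M s" using bsuper_bound assms by metis
  show ?thesis
  proof (rule bsuperI)
    show "ereal c \<le> (if prefix s t then M t else \<infinity>)" for t using c by simp
    show "upward_ext (Q t) (\<lambda>x. if prefix s (t @ [x]) then M (t @ [x]) else \<infinity>)
        \<le> (if prefix s t then M t else \<infinity>)" for t
    proof (cases "prefix s t")
      case True
      then have "prefix s (t @ [x])" for x by simp
      then show ?thesis using True bsuperD[OF assms] by simp
    qed simp
  qed
qed

lemma bsuper_path:
  assumes "bsuper M"
  shows "\<exists>\<omega>\<in>cylinder s. \<forall>n\<ge>length s. M (prefix_of \<omega> n) \<le> M s"
proof -
  have "\<exists>x. M (t @ [x]) \<le> M t" for t
    using upward_ext_attains[OF Q_coherent[of t], of "\<lambda>x. M (t @ [x])"] bsuperD[OF assms, of t] order_trans by blast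
  then obtain x where x: "\<And>t. M (t @ [x t]) \<le> M t" by metis
  define \<omega> where "\<omega> = follow (\<lambda>t. if length t < length s then s ! length t else x t)"
  have mem: "\<omega> \<in> cylinder s" unfolding \<omega>_def follow_mem_cylinder_iff by simp
  have "M (prefix_of \<omega> n) \<le> M s" if "length s \<le> n" for n
    using that
  proof (induction n rule: dec_induct)
    case base
    then show ?case using mem by (simp add: prefix_of_mem_cylinder)
  next
    case (step n)
    have "\<omega> n = x (prefix_of \<omega> n)" unfolding \<omega>_def using step(1) by (subst follow_eq) simp
    then have "prefix_of \<omega> (Suc n) = prefix_of \<omega> n @ [x (prefix_of \<omega> n)]" by (simp add: prefix_of_Suc)
    then show ?case using x[of "prefix_of \<omega> n"] step(3) by simp
  qed
  then show ?thesis using mem by blast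
qed

section \<open>Elementary properties of the game-theoretic upper expectation\<close>

definition dominates :: "('x situation \<Rightarrow> ereal) \<Rightarrow> 'x situation \<Rightarrow> 'x global_variable \<Rightarrow> bool" where
  "dominates M s f \<longleftrightarrow> (\<forall>\<omega>\<in>cylinder s. f \<omega> \<le> liminf (\<lambda>n. M (prefix_of \<omega> n)))"

abbreviation EV :: "'x global_upper" where "EV \<equiv> E_V Q"

lemma EV_alt: "EV f s = Inf {M s | M. bsuper M \<and> dominates M s f}"
  unfolding E_V_def bsuper_iff dominates_def by (simp add: conj_assoc)

lemma EV_le: "bsuper M \<Longrightarrow> dominates M s f \<Longrightarrow> EV f s \<le> M s"
  unfolding EV_alt by (rule Inf_lower) auto

lemma EV_greatest: "(\<And>M. bsuper M \<Longrightarrow> dominates M s f \<Longrightarrow> y \<le> M s) \<Longrightarrow> y \<le> EV f s"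
  unfolding EV_alt by (rule Inf_greatest) auto

lemma EV_mono:
  assumes "\<And>\<omega>. \<omega> \<in> cylinder s \<Longrightarrow> f \<omega> \<le> g \<omega>"
  shows "EV f s \<le> EV g s"
proof (rule EV_greatest)
  fix M assume "bsuper M" "dominates M s g"
  then show "EV f s \<le> M s" using assms by (intro EV_le) (auto simp: dominates_def intro: order_trans)
qed

lemma EV_cong:
  assumes "\<And>\<omega>. \<omega> \<in> cylinder s \<Longrightarrow> f \<omega> = g \<omega>"
  shows "EV f s = EV g s"
  by (intro antisym EV_mono) (auto simp: assms)

text \<open>
  Along a path on which \<open>M\<close> never exceeds \<open>M s\<close>, its lower limit is at most \<open>M s\<close>.
\<close>

lemma dominates_ge:
  assumes M: "bsuper M" "dominates M s f" and f: "\<And>\<omega>. \<omega> \<in> cylinder s \<Longrightarrow> y \<le> f \<omega>"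
  shows "y \<le> M s"
proof -
  obtain \<omega> where \<omega>: "\<omega> \<in> cylinder s" "\<And>n. n \<ge> length s \<Longrightarrow> M (prefix_of \<omega> n) \<le> M s"
    using bsuper_path[OF M(1)] by blast
  have "y \<le> liminf (\<lambda>n. M (prefix_of \<omega> n))"
    using f[OF \<omega>(1)] M(2) \<omega>(1) by (auto simp: dominates_def intro: order_trans)
  also have "\<dots> \<le> liminf (\<lambda>n. M s)"
    by (rule Liminf_mono) (use \<omega>(2) in \<open>auto simp: eventually_sequentially\<close>)
  finally show ?thesis by (simp add: Liminf_const)
qed

lemma dominates_extension:
  "dominates M s f \<Longrightarrow> prefix s t \<Longrightarrow> dominates M t f"
  using cylinder_antimono unfolding dominates_def by blast

lemma EV_ge: "(\<And>\<omega>. \<omega> \<in> cylinder s \<Longrightarrow> y \<le> f \<omega>) \<Longrightarrow> y \<le> EV f s"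
  by (rule EV_greatest) (rule dominates_ge)

lemma EV_const_le:
  assumes "\<And>\<omega>. \<omega> \<in> cylinder s \<Longrightarrow> f \<omega> \<le> ereal c" shows "EV f s \<le> ereal c"
  using EV_le[OF bsuper_const[of c], of s f] assms by (simp add: dominates_def Liminf_const)

lemma EV_const:
  assumes "\<And>\<omega>. \<omega> \<in> cylinder s \<Longrightarrow> f \<omega> = ereal c" shows "EV f s = ereal c"
  by (intro antisym EV_const_le EV_ge) (simp_all add: assms)

text \<open>
  Near-optimal supermartingales can be chosen with the same lower bound as the variable, uniformly
  over all situations. Pasting and infinite sums of supermartingales rely on this uniformity.
\<close>

lemma EV_witness:
  assumes f: "\<And>\<omega>. ereal c \<le> f \<omega>" and y: "EV f s < y"
  obtains M where "bsuper M" "dominates M s f" "M s < y" "\<And>t. ereal c \<le> M t"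
proof -
  obtain M where M: "bsuper M" "dominates M s f" "M s < y"
    using y unfolding EV_alt Inf_less_iff by auto
  let ?M = "\<lambda>t. if prefix s t then M t else \<infinity>"
  have 1: "bsuper ?M" by (rule bsuper_restrict) fact
  have 2: "dominates ?M s f" unfolding dominates_def
  proof
    fix \<omega> assume w: "\<omega> \<in> cylinder s"
    have "liminf (\<lambda>n. ?M (prefix_of \<omega> n)) = liminf (\<lambda>n. M (prefix_of \<omega> n))"
      by (rule Liminf_eq) (use w in \<open>auto simp: eventually_sequentially prefix_prefix_of_iff intro!: exI[of _ "length s"]\<close>)
    then show "f \<omega> \<le> liminf (\<lambda>n. ?M (prefix_of \<omega> n))" using M w by (auto simp: dominates_def)
  qed
  have 3: "ereal c \<le> ?M t" for t
    using dominates_ge[OF M(1) dominates_extension[OF M(2)], of t "ereal c"] f by auto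
  from that[OF 1 2 _ 3] M(3) show thesis by simp
qed

text \<open>
  Every supermartingale that is admissible at \<open>s\<close> is admissible at all successors of \<open>s\<close>, hence
  lies above \<open>EV f\<close> there.
\<close>

lemma bsuper_EV:
  assumes f: "\<And>\<omega>. ereal c \<le> f \<omega>"
  shows "bsuper (EV f)"
proof (rule bsuperI)
  show "ereal c \<le> EV f s" for s using f by (intro EV_ge) auto
  fix s
  show "upward_ext (Q s) (\<lambda>x. EV f (s @ [x])) \<le> EV f s"
  proof (rule EV_greatest)
    fix M assume M: "bsuper M" "dominates M s f"
    have "upward_ext (Q s) (\<lambda>x. EV f (s @ [x])) \<le> upward_ext (Q s) (\<lambda>x. M (s @ [x]))"
      using M by (intro upward_ext_mono EV_le) (auto intro: dominates_extension)
    also have "\<dots> \<le> M s" by (rule bsuperD) fact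
    finally show "upward_ext (Q s) (\<lambda>x. EV f (s @ [x])) \<le> M s" .
  qed
qed

lemma dominates_add:
  assumes "bsuper M" "bsuper N" "dominates M s f" "dominates N s g"
  shows "dominates (\<lambda>t. M t + N t) s (\<lambda>\<omega>. f \<omega> + g \<omega>)"
proof -
  from bsuper_common_bound[OF assms(1,2)] obtain c
    where c: "\<And>s. ereal c \<le> M s" "\<And>s. ereal c \<le> N s" by metis
  show ?thesis unfolding dominates_def
  proof
    fix \<omega> assume "\<omega> \<in> cylinder s"
    then show "f \<omega> + g \<omega> \<le> liminf (\<lambda>n. M (prefix_of \<omega> n) + N (prefix_of \<omega> n))"
      using assms(3,4) unfolding dominates_def by (intro le_liminf_add[OF c]) auto
  qed
qed

lemma EV_add:
  assumes f: "\<And>\<omega>. ereal c \<le> f \<omega>" and g: "\<And>\<omega>. ereal c \<le> g \<omega>"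
  shows "EV (\<lambda>\<omega>. f \<omega> + g \<omega>) s \<le> EV f s + EV g s"
proof (cases "EV f s = \<infinity> \<or> EV g s = \<infinity>")
  case False
  have "ereal c \<le> EV f s" "ereal c \<le> EV g s" using f g by (auto intro!: EV_ge)
  then obtain x y where xy: "EV f s = ereal x" "EV g s = ereal y"
    using False by (cases "EV f s"; cases "EV g s") auto
  show ?thesis
  proof (rule ereal_le_epsilon2)
    fix e :: real assume e: "0 < e"
    obtain M where M: "bsuper M" "dominates M s f" "M s < ereal (x + e / 2)"
      using EV_witness[of c f s "ereal (x + e / 2)", OF f] xy e by auto
    obtain N where N: "bsuper N" "dominates N s g" "N s < ereal (y + e / 2)"
      using EV_witness[of c g s "ereal (y + e / 2)", OF g] xy e by auto
    have "EV (\<lambda>\<omega>. f \<omega> + g \<omega>) s \<le> M s + N s"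
      using M N by (intro EV_le bsuper_add dominates_add)
    also have "\<dots> \<le> ereal (x + e / 2) + ereal (y + e / 2)"
      using M(3) N(3) by (intro add_mono less_imp_le)
    also have "\<dots> = EV f s + EV g s + ereal e" by (simp add: xy)
    finally show "EV (\<lambda>\<omega>. f \<omega> + g \<omega>) s \<le> EV f s + EV g s + ereal e" .
  qed
qed auto

text \<open>
  Witnesses with initial values \<open>e / 2, e / 4, \<dots>\<close> add up to one supermartingale of initial value
  at most \<open>e\<close>. With its corollaries for unions and for \<open>\<infinity>\<close> times an indicator it lets countably
  many exceptional events be ignored.
\<close>

lemma EV_null_suminf:
  assumes pos: "\<And>k \<omega>. 0 \<le> f k \<omega>" and null: "\<And>k. EV (f k) s \<le> 0"
  shows "EV (\<lambda>\<omega>. \<Sum>k. f k \<omega>) s \<le> 0"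
proof (rule ereal_le_epsilon2)
  fix e :: real assume e: "0 < e"
  have "\<exists>M. bsuper M \<and> dominates M s (f k) \<and> M s < ereal (e * (1 / 2) ^ Suc k) \<and> (\<forall>t. 0 \<le> M t)" for k
  proof -
    have "EV (f k) s < ereal (e * (1 / 2) ^ Suc k)"
      using e by (intro le_less_trans[OF null]) auto
    then show ?thesis using EV_witness[of 0 "f k" s] pos by (metis zero_ereal_def)
  qed
  then obtain M where M: "\<And>k. bsuper (M k)" "\<And>k. dominates (M k) s (f k)"
    "\<And>k. M k s < ereal (e * (1 / 2) ^ Suc k)" "\<And>k t. 0 \<le> M k t"
    by metis
  have "dominates (\<lambda>t. \<Sum>k. M k t) s (\<lambda>\<omega>. \<Sum>k. f k \<omega>)"
    unfolding dominates_def
  proof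
    fix \<omega> assume \<omega>: "\<omega> \<in> cylinder s"
    have part: "(\<Sum>k<K. f k \<omega>) \<le> liminf (\<lambda>n. \<Sum>k<K. M k (prefix_of \<omega> n))" for K
    proof (induction K)
      case 0
      then show ?case by (simp add: Liminf_const)
    next
      case (Suc K)
      have "(\<Sum>k<K. f k \<omega>) + f K \<omega> \<le> liminf (\<lambda>n. (\<Sum>k<K. M k (prefix_of \<omega> n)) + M K (prefix_of \<omega> n))"
        using Suc M(2,4) \<omega> by (intro le_liminf_add[of 0]) (auto simp: dominates_def sum_nonneg zero_ereal_def[symmetric])
      then show ?case by simp
    qed
    have "(\<Sum>k<K. f k \<omega>) \<le> liminf (\<lambda>n. \<Sum>k. M k (prefix_of \<omega> n))" for K
      by (rule order_trans[OF part Liminf_mono]) (auto intro!: always_eventually suminf_upper M(4))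
    then show "(\<Sum>k. f k \<omega>) \<le> liminf (\<lambda>n. \<Sum>k. M k (prefix_of \<omega> n))"
      by (intro suminf_bound allI pos)
  qed
  then have "EV (\<lambda>\<omega>. \<Sum>k. f k \<omega>) s \<le> (\<Sum>k. M k s)"
    using M by (intro EV_le bsuper_suminf)
  also have "\<dots> \<le> (\<Sum>k. ereal (e * (1 / 2) ^ Suc k))"
    by (rule suminf_le_pos) (use M in \<open>auto intro: less_imp_le\<close>)
  also have "\<dots> = ereal (e * 1)"
    using sums_mult[OF power_half_series, of e] by (intro sums_unique[symmetric]) (simp only: sums_ereal)
  also have "\<dots> = 0 + ereal e" by simp
  finally show "EV (\<lambda>\<omega>. \<Sum>k. f k \<omega>) s \<le> 0 + ereal e" .
qed

abbreviation null :: "'x path set \<Rightarrow> 'x situation \<Rightarrow> bool" where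
  "null A s \<equiv> EV (indicator A) s \<le> 0"

lemma null_UN:
  fixes A :: "nat \<Rightarrow> 'x path set"
  assumes "\<And>k. null (A k) s" shows "null (\<Union>k. A k) s"
proof -
  have "EV (indicator (\<Union>k. A k)) s \<le> EV (\<lambda>\<omega>. \<Sum>k. indicator (A k) \<omega>) s"
  proof (rule EV_mono)
    fix \<omega>
    have "indicator (A k) \<omega> \<le> (\<Sum>k. indicator (A k) \<omega> :: ereal)" for k
    proof -
      have "indicator (A k) \<omega> \<le> (\<Sum>k<Suc k. indicator (A k) \<omega> :: ereal)"
        by (simp add: add_increasing sum_nonneg)
      also have "\<dots> \<le> (\<Sum>k. indicator (A k) \<omega>)" by (rule suminf_upper) simp
      finally show ?thesis .
    qed
    then have le: "indicator (A k) \<omega> \<le> (\<Sum>k. indicator (A k) \<omega> :: ereal)" for k .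
    show "indicator (\<Union>k. A k) \<omega> \<le> (\<Sum>k. indicator (A k) \<omega> :: ereal)"
    proof (cases "\<omega> \<in> (\<Union>k. A k)")
      case True
      then obtain k where "\<omega> \<in> A k" by blast
      then show ?thesis using le[of k] True by simp
    next
      case False
      then show ?thesis by (simp add: suminf_0_le)
    qed
  qed
  also have "\<dots> \<le> 0" using assms by (intro EV_null_suminf) auto
  finally show ?thesis .
qed

lemma EV_infinity_null:
  assumes "null A s" shows "EV (\<lambda>\<omega>. \<infinity> * indicator A \<omega>) s \<le> 0"
proof -
  have "EV (\<lambda>\<omega>. \<infinity> * indicator A \<omega>) s \<le> EV (\<lambda>\<omega>. \<Sum>k::nat. indicator A \<omega>) s"
  proof (rule EV_mono)
    fix \<omega>
    have "\<infinity> \<le> (\<Sum>k::nat. 1 :: ereal)"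
    proof -
      have "ereal (real n) \<le> (\<Sum>k::nat. 1 :: ereal)" for n
      proof -
        have "(\<Sum>k<n. 1 :: ereal) = ereal (real n)" by (induction n) (auto simp: one_ereal_def)
        then show ?thesis using suminf_upper[of "\<lambda>k. 1" n] by simp
      qed
      then have "\<not> (\<exists>n. (\<Sum>k::nat. 1 :: ereal) < ereal (real n))" by (simp add: not_less)
      then show ?thesis by (simp add: less_PInf_Ex_of_nat[symmetric])
    qed
    then show "\<infinity> * indicator A \<omega> \<le> (\<Sum>k::nat. indicator A \<omega> :: ereal)"
      by (simp add: indicator_def)
  qed
  also have "\<dots> \<le> 0" using assms by (intro EV_null_suminf) auto
  finally show ?thesis .
qed

section \<open>Optional stopping and upcrossings\<close>

text \<open>
  Follow \<open>M\<close> until the first situation \<open>v\<close> with \<open>EV g v \<le> M v\<close>, and from there on a near-optimal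
  supermartingale \<open>S v\<close> for \<open>g\<close>. Up to the margin \<open>e\<close> the switch never increases the capital, so
  the pasted process \<open>M'\<close> is a supermartingale, and on every path its lower limit is at least \<open>g\<close>.
\<close>

lemma EV_optional_stopping:
  assumes M: "bsuper M" and g: "\<And>\<omega>. ereal c \<le> g \<omega>"
    and opt: "\<And>\<omega>. \<omega> \<in> cylinder t \<Longrightarrow> g \<omega> \<le> liminf (\<lambda>n. M (prefix_of \<omega> n)) \<or>
      (\<exists>n\<ge>length t. EV g (prefix_of \<omega> n) \<le> M (prefix_of \<omega> n))"
  shows "EV g t \<le> M t"
proof (rule ereal_le_epsilon2)
  fix e :: real assume e: "0 < e"
  obtain m where m: "\<And>v. ereal m \<le> M v" using bsuper_bound M by metis
  define B where "B = {v. EV g v \<le> M v}"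
  have "\<exists>S. bsuper S \<and> dominates S v g \<and> S v \<le> M v + ereal e \<and> (\<forall>w. ereal c \<le> S w)" if "v \<in> B" for v
  proof (cases "M v = \<infinity>")
    case True
    have "bsuper (\<lambda>_. \<infinity>)" by (rule bsuperI[of 0]) auto
    then show ?thesis using True by (intro exI[of _ "\<lambda>_. \<infinity>"]) (auto simp: dominates_def Liminf_const)
  next
    case False
    then have "M v < M v + ereal e" using m[of v] e by (cases "M v") auto
    then have "EV g v < M v + ereal e" using that by (auto simp: B_def)
    from EV_witness[OF g this] show ?thesis by (metis less_imp_le)
  qed
  then obtain S where S: "\<And>v. v \<in> B \<Longrightarrow> bsuper (S v)" "\<And>v. v \<in> B \<Longrightarrow> dominates (S v) v g"
    "\<And>v. v \<in> B \<Longrightarrow> S v v \<le> M v + ereal e" "\<And>v w. v \<in> B \<Longrightarrow> ereal c \<le> S v w"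
    by metis
  \<comment> \<open>\<open>hit v k\<close>: on the way to \<open>v\<close>, the prefix of length \<open>k\<close> is a switching point.\<close>
  define hit where "hit v k \<longleftrightarrow> length t \<le> k \<and> k \<le> length v \<and> take k v \<in> B" for v k
  define first where "first v = (LEAST k. hit v k)" for v
  define M' where "M' v = (if \<exists>k. hit v k then S (take (first v) v) v else M v + ereal e)" for v
  have hit_first: "hit v (first v)" if "\<exists>k. hit v k" for v
    unfolding first_def using that by (rule LeastI_ex)
  have first_append: "first (v @ [x]) = first v" "hit (v @ [x]) (first v)" if "\<exists>k. hit v k" for v x
  proof -
    show *: "hit (v @ [x]) (first v)" using hit_first[OF that] by (auto simp: hit_def)
    show "first (v @ [x]) = first v" unfolding first_def[of "v @ [x]"]
    proof (rule Least_equality)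
      fix k assume k: "hit (v @ [x]) k"
      show "first v \<le> k"
      proof (cases "k \<le> length v")
        case True
        then have "hit v k" using k by (auto simp: hit_def)
        then show ?thesis unfolding first_def by (rule Least_le)
      qed (use hit_first[OF that] in \<open>auto simp: hit_def\<close>)
    qed (fact *)
  qed
  have sup: "bsuper M'"
  proof (rule bsuperI)
    show "ereal (min c m) \<le> M' v" for v
    proof (cases "\<exists>k. hit v k")
      case True
      then show ?thesis using hit_first[OF True] S(4)[of "take (first v) v" v]
        by (auto simp: M'_def hit_def intro: order_trans[of _ "ereal c"] simp del: ereal_min)
    next
      case False
      have "ereal (min c m) \<le> ereal m" by simp
      also have "\<dots> \<le> M v" by (rule m)
      also have "\<dots> \<le> M v + ereal e" using e by (simp add: add_increasing2)
      finally show ?thesis using False by (simp add: M'_def)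
    qed
    fix v
    show "upward_ext (Q v) (\<lambda>x. M' (v @ [x])) \<le> M' v"
    proof (cases "\<exists>k. hit v k")
      case True
      have "M' (v @ [x]) = S (take (first v) v) (v @ [x])" for x
      proof -
        have "\<exists>k. hit (v @ [x]) k" using first_append(2)[OF True] by blast
        moreover have "first v \<le> length v" using hit_first[OF True] by (simp add: hit_def)
        ultimately show ?thesis using first_append(1)[OF True, of x] by (simp add: M'_def)
      qed
      moreover have "M' v = S (take (first v) v) v" using True by (simp add: M'_def)
      moreover have "bsuper (S (take (first v) v))" using hit_first[OF True] by (intro S) (auto simp: hit_def)
      ultimately show ?thesis by (simp add: bsuperD)
    next
      case False
      have "M' (v @ [x]) \<le> M (v @ [x]) + ereal e" for x
      proof (cases "\<exists>k. hit (v @ [x]) k")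
        case True
        then have h: "hit (v @ [x]) (first (v @ [x]))" by (rule hit_first)
        have "\<not> first (v @ [x]) \<le> length v" using False h by (auto simp: hit_def)
        then have "take (first (v @ [x])) (v @ [x]) = v @ [x]" by simp
        then show ?thesis using True h S(3)[of "v @ [x]"] by (auto simp: M'_def hit_def)
      qed (simp add: M'_def)
      then have "upward_ext (Q v) (\<lambda>x. M' (v @ [x])) \<le> upward_ext (Q v) (\<lambda>x. M (v @ [x]) + ereal e)"
        by (rule upward_ext_mono)
      also have "\<dots> \<le> M v + ereal e" using bsuperD[OF bsuper_add[OF M bsuper_const[of e]]] .
      finally show ?thesis using False by (simp add: M'_def)
    qed
  qed
  have dom: "dominates M' t g"
    unfolding dominates_def
  proof
    fix \<omega> assume \<omega>: "\<omega> \<in> cylinder t"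
    show "g \<omega> \<le> liminf (\<lambda>n. M' (prefix_of \<omega> n))"
    proof (cases "\<exists>n\<ge>length t. prefix_of \<omega> n \<in> B")
      case True
      define k where "k = (LEAST n. length t \<le> n \<and> prefix_of \<omega> n \<in> B)"
      have k: "length t \<le> k" "prefix_of \<omega> k \<in> B"
        using LeastI_ex[OF True] unfolding k_def by auto
      have "M' (prefix_of \<omega> n) = S (prefix_of \<omega> k) (prefix_of \<omega> n)" if n: "k \<le> n" for n
      proof -
        have hk: "hit (prefix_of \<omega> n) k" using k n by (simp add: hit_def take_prefix_of min_absorb1)
        moreover have "first (prefix_of \<omega> n) = k" unfolding first_def
        proof (rule Least_equality)
          show "hit (prefix_of \<omega> n) k" by (rule hk)
          fix y assume "hit (prefix_of \<omega> n) y"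
          then show "k \<le> y" unfolding k_def by (intro Least_le) (auto simp: hit_def take_prefix_of min_absorb1)
        qed
        ultimately show ?thesis using n by (auto simp: M'_def take_prefix_of min_absorb1)
      qed
      then have "liminf (\<lambda>n. M' (prefix_of \<omega> n)) = liminf (\<lambda>n. S (prefix_of \<omega> k) (prefix_of \<omega> n))"
        by (intro Liminf_eq) (auto simp: eventually_sequentially)
      then show ?thesis using S(2)[OF k(2)] by (simp add: dominates_def)
    next
      case False
      then have "g \<omega> \<le> liminf (\<lambda>n. M (prefix_of \<omega> n))" using opt[OF \<omega>] by (auto simp: B_def)
      also have "\<dots> \<le> liminf (\<lambda>n. M' (prefix_of \<omega> n))"
      proof (rule Liminf_mono, rule always_eventually, rule allI)
        fix n
        have "\<not> hit (prefix_of \<omega> n) k" for k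
          using False by (auto simp: hit_def take_prefix_of min_absorb1)
        then show "M (prefix_of \<omega> n) \<le> M' (prefix_of \<omega> n)" using e by (simp add: M'_def add_increasing2)
      qed
      finally show ?thesis .
    qed
  qed
  have "EV g t \<le> M' t" using sup dom by (rule EV_le)
  also have "\<dots> \<le> M t + ereal e"
  proof (cases "\<exists>k. hit t k")
    case True
    then have "hit t (first t)" by (rule hit_first)
    then have "first t = length t" "t \<in> B" by (auto simp: hit_def)
    then show ?thesis using True S(3)[of t] by (simp add: M'_def)
  qed (simp add: M'_def)
  finally show "EV g t \<le> M t + ereal e" .
qed

text \<open>
  Let \<open>\<beta>\<close> be the supremum of the upper probabilities of \<open>A\<close> over all situations. Starting in
  \<open>u \<in> W\<close>, the supermartingale \<open>(\<beta> / b) * N u\<close> reaches \<open>\<beta>\<close>, and so the upper probability of \<open>A\<close>, on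
  every path of \<open>A\<close>; optional stopping gives the bound \<open>(\<beta> / b) * a\<close> at \<open>u\<close>. Since all paths of
  \<open>A\<close> visit \<open>W\<close>, stopping a constant process transfers this bound to every situation. Hence
  \<open>\<beta> \<le> (a / b) * \<beta>\<close>, which forces \<open>\<beta> = 0\<close>. No infinite succession of upcrossings has to be
  composed explicitly.
\<close>

lemma null_upcrossings:
  fixes a b :: real
  assumes ab: "0 \<le> a" "a < b"
    and N: "\<And>u. u \<in> W \<Longrightarrow> bsuper (N u)" "\<And>u v. u \<in> W \<Longrightarrow> 0 \<le> N u v" "\<And>u. u \<in> W \<Longrightarrow> N u u \<le> ereal a"
    and low: "\<And>\<omega> m. \<omega> \<in> A \<Longrightarrow> \<exists>n\<ge>m. prefix_of \<omega> n \<in> W"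
    and up: "\<And>\<omega> n. \<omega> \<in> A \<Longrightarrow> prefix_of \<omega> n \<in> W \<Longrightarrow> \<exists>k\<ge>n. ereal b \<le> N (prefix_of \<omega> n) (prefix_of \<omega> k)"
  shows "null A s"
proof -
  let ?I = "indicator A :: 'x path \<Rightarrow> ereal"
  have I: "ereal 0 \<le> ?I \<omega>" "?I \<omega> \<le> ereal 1" for \<omega> by (auto simp: indicator_def)
  define \<beta> where "\<beta> = (SUP t. EV ?I t)"
  have le: "EV ?I t \<le> \<beta>" for t unfolding \<beta>_def by (rule SUP_upper) simp
  have "0 \<le> EV ?I t" for t using I by (intro EV_ge) (simp add: zero_ereal_def)
  then have "0 \<le> \<beta>" using le order_trans by blast
  moreover have "\<beta> \<le> 1" unfolding \<beta>_def
    using EV_const_le[OF I(2)] by (intro SUP_least) (simp add: one_ereal_def)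
  ultimately obtain r where r: "\<beta> = ereal r" "0 \<le> r" by (cases \<beta>) auto
  have b: "0 < b" using ab by simp
  have step1: "EV ?I u \<le> ereal (r / b * a)" if u: "u \<in> W" for u
  proof -
    have rb: "0 \<le> r / b" using r b by simp
    have "EV ?I u \<le> ereal (r / b) * N u u"
    proof (rule EV_optional_stopping[OF bsuper_cmult[OF N(1)[OF u] rb] I(1)])
      fix \<omega> assume \<omega>: "\<omega> \<in> cylinder u"
      show "?I \<omega> \<le> liminf (\<lambda>n. ereal (r / b) * N u (prefix_of \<omega> n)) \<or>
        (\<exists>n\<ge>length u. EV ?I (prefix_of \<omega> n) \<le> ereal (r / b) * N u (prefix_of \<omega> n))"
      proof (cases "\<omega> \<in> A")
        case True
        then obtain k where k: "length u \<le> k" "ereal b \<le> N u (prefix_of \<omega> k)"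
          using up[OF True, of "length u"] \<omega> u by (auto simp: prefix_of_mem_cylinder)
        have "EV ?I (prefix_of \<omega> k) \<le> ereal (r / b) * ereal b" using le r b by simp
        also have "\<dots> \<le> ereal (r / b) * N u (prefix_of \<omega> k)"
          using k rb by (intro ereal_mult_left_mono) auto
        finally show ?thesis using k by blast
      next
        case False
        have "0 \<le> liminf (\<lambda>n. ereal (r / b) * N u (prefix_of \<omega> n))"
          using N(2)[OF u] rb by (intro Liminf_bounded always_eventually) auto
        then show ?thesis using False by simp
      qed
    qed
    also have "\<dots> \<le> ereal (r / b) * ereal a"
      using N(3)[OF u] rb by (intro ereal_mult_left_mono) auto
    finally show ?thesis by simp
  qed
  have step2: "EV ?I t \<le> ereal (r / b * a)" for t
  proof (rule EV_optional_stopping[OF bsuper_const I(1)])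
    fix \<omega> assume \<omega>: "\<omega> \<in> cylinder t"
    show "?I \<omega> \<le> liminf (\<lambda>n. ereal (r / b * a)) \<or> (\<exists>n\<ge>length t. EV ?I (prefix_of \<omega> n) \<le> ereal (r / b * a))"
    proof (cases "\<omega> \<in> A")
      case True
      then show ?thesis using low[OF True, of "length t"] step1 by blast
    next
      case False
      then show ?thesis using r b ab by (simp add: Liminf_const)
    qed
  qed
  then have "\<beta> \<le> ereal (r / b * a)" unfolding \<beta>_def by (rule SUP_least)
  then have "r \<le> r / b * a" using r by simp
  then have "r * (b - a) \<le> 0" using b by (simp add: field_simps)
  then have "r = 0" using ab r by (simp add: mult_le_0_iff)
  then show ?thesis using le[of s] r by (simp add: zero_ereal_def)
qed

text \<open>
  A strict inequality is witnessed by one of countably many pairs of rationals.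
\<close>

lemma null_less:
  fixes X Y :: "'x path \<Rightarrow> ereal"
  assumes "\<And>a b::real. a < b \<Longrightarrow> null {\<omega>. X \<omega> < ereal a \<and> ereal b < Y \<omega>} s"
  shows "null {\<omega>. X \<omega> < Y \<omega>} s"
proof -
  define D where "D k = (let (a, b) = from_nat k :: rat \<times> rat in
    if a < b then {\<omega>. X \<omega> < ereal (of_rat a) \<and> ereal (of_rat b) < Y \<omega>} else {})" for k
  have "null (D k) s" for k
    using assms EV_const_le[of s "\<lambda>_. 0" 0] unfolding D_def
    by (auto simp: split_beta Let_def of_rat_less indicator_def[abs_def] zero_ereal_def)
  then have "null (\<Union>k. D k) s" by (rule null_UN)
  moreover have "{\<omega>. X \<omega> < Y \<omega>} \<subseteq> (\<Union>k. D k)"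
  proof
    fix \<omega> assume "\<omega> \<in> {\<omega>. X \<omega> < Y \<omega>}"
    then obtain a where a: "X \<omega> < ereal (of_rat a)" "ereal (of_rat a) < Y \<omega>"
      using ereal_dense3 by blast
    then obtain b where b: "ereal (of_rat a) < ereal (of_rat b)" "ereal (of_rat b) < Y \<omega>"
      using ereal_dense3 by blast
    then have "\<omega> \<in> D (to_nat (a, b))" using a by (simp add: D_def of_rat_less)
    then show "\<omega> \<in> (\<Union>k. D k)" by blast
  qed
  then have "EV (indicator {\<omega>. X \<omega> < Y \<omega>}) s \<le> EV (indicator (\<Union>k. D k)) s"
    by (intro EV_mono) (auto simp: indicator_def)
  ultimately show ?thesis by (rule order_trans[rotated])
qed

lemma bsuper_shift: "bsuper M \<Longrightarrow> bsuper (\<lambda>t. M t - ereal c)"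
  using bsuper_add[OF _ bsuper_const[of "- c"]] by (simp add: minus_ereal_def)

lemma null_empty: "null {} s"
  using EV_const_le[of s "\<lambda>_. 0" 0] by (simp add: indicator_def[abs_def] zero_ereal_def)

text \<open>
  Levy's zero-one law. If \<open>EV f\<close> keeps returning below \<open>a\<close> while \<open>b < f \<omega>\<close>, then at each return a
  supermartingale for \<open>f\<close> can be bought for less than \<open>a\<close>, and it later exceeds \<open>b\<close>.
\<close>

lemma EV_levy:
  assumes f: "\<And>\<omega>. ereal c \<le> f \<omega>"
  shows "null {\<omega>. liminf (\<lambda>n. EV f (prefix_of \<omega> n)) < f \<omega>} s"
proof (rule null_less)
  fix a b :: real assume ab: "a < b"
  let ?A = "{\<omega>. liminf (\<lambda>n. EV f (prefix_of \<omega> n)) < ereal a \<and> ereal b < f \<omega>}"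
  show "null ?A s"
  proof (cases "c \<le> a")
    case False
    have "ereal c \<le> liminf (\<lambda>n. EV f (prefix_of \<omega> n))" for \<omega>
      using f by (intro Liminf_bounded always_eventually allI EV_ge)
    then have "?A = {}" using False by (force dest: le_less_trans)
    then show ?thesis by (simp only: null_empty)
  next
    case True
    define W where "W = {u. EV f u < ereal a}"
    have "\<exists>N. bsuper N \<and> dominates N u f \<and> N u < ereal a \<and> (\<forall>t. ereal c \<le> N t)" if "u \<in> W" for u
      using EV_witness[of c f u "ereal a", OF f] that unfolding W_def by blast
    then obtain N where N: "\<And>u. u \<in> W \<Longrightarrow> bsuper (N u)" "\<And>u. u \<in> W \<Longrightarrow> dominates (N u) u f"
      "\<And>u. u \<in> W \<Longrightarrow> N u u < ereal a" "\<And>u t. u \<in> W \<Longrightarrow> ereal c \<le> N u t"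
      by metis
    show ?thesis
    proof (rule null_upcrossings[of "a - c" "b - c" W "\<lambda>u t. N u t - ereal c"])
      fix u assume u: "u \<in> W"
      show "bsuper (\<lambda>t. N u t - ereal c)" using N(1)[OF u] by (rule bsuper_shift)
      show "0 \<le> N u t - ereal c" for t using N(4)[OF u, of t] by (cases "N u t") auto
      show "N u u - ereal c \<le> ereal (a - c)" using N(3)[OF u] by (cases "N u u") auto
    next
      fix \<omega> m assume "\<omega> \<in> ?A"
      then show "\<exists>n\<ge>m. prefix_of \<omega> n \<in> W" using liminf_less_frequently unfolding W_def by blast
    next
      fix \<omega> n assume A: "\<omega> \<in> ?A" and n: "prefix_of \<omega> n \<in> W"
      have "f \<omega> \<le> liminf (\<lambda>k. N (prefix_of \<omega> n) (prefix_of \<omega> k))"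
        using N(2)[OF n] by (simp add: dominates_def)
      then have "ereal b < liminf (\<lambda>k. N (prefix_of \<omega> n) (prefix_of \<omega> k))" using A by (auto dest: less_le_trans)
      from less_LiminfD[OF this] obtain K where "\<And>k. k \<ge> K \<Longrightarrow> ereal b < N (prefix_of \<omega> n) (prefix_of \<omega> k)"
        by (auto simp: eventually_sequentially)
      then have "ereal b < N (prefix_of \<omega> n) (prefix_of \<omega> (max n K))" by simp
      then have "ereal (b - c) \<le> N (prefix_of \<omega> n) (prefix_of \<omega> (max n K)) - ereal c"
        by (cases "N (prefix_of \<omega> n) (prefix_of \<omega> (max n K))") auto
      then show "\<exists>k\<ge>n. ereal (b - c) \<le> N (prefix_of \<omega> n) (prefix_of \<omega> k) - ereal c"
        by (meson max.cobounded1)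
    qed (use ab True in auto)
  qed
qed

text \<open>
  Doob's convergence theorem: where \<open>M\<close> oscillates, \<open>M\<close> itself performs the upcrossings.
\<close>

lemma bsuper_converges:
  assumes M: "bsuper M"
  shows "null {\<omega>. liminf (\<lambda>n. M (prefix_of \<omega> n)) < limsup (\<lambda>n. M (prefix_of \<omega> n))} s"
proof (rule null_less)
  obtain c where c: "\<And>t. ereal c \<le> M t" using bsuper_bound M by metis
  fix a b :: real assume ab: "a < b"
  let ?A = "{\<omega>. liminf (\<lambda>n. M (prefix_of \<omega> n)) < ereal a \<and> ereal b < limsup (\<lambda>n. M (prefix_of \<omega> n))}"
  show "null ?A s"
  proof (cases "c \<le> a")
    case False
    have "ereal c \<le> liminf (\<lambda>n. M (prefix_of \<omega> n))" for \<omega>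
      using c by (intro Liminf_bounded always_eventually allI)
    then have "?A = {}" using False by (force dest: le_less_trans)
    then show ?thesis by (simp only: null_empty)
  next
    case True
    show ?thesis
    proof (rule null_upcrossings[of "a - c" "b - c" "{u. M u < ereal a}" "\<lambda>u t. M t - ereal c"])
      fix u assume "u \<in> {u. M u < ereal a}"
      then show "M u - ereal c \<le> ereal (a - c)" by (cases "M u") auto
      show "bsuper (\<lambda>t. M t - ereal c)" using M by (rule bsuper_shift)
      show "0 \<le> M t - ereal c" for t using c[of t] by (cases "M t") auto
    next
      fix \<omega> m assume "\<omega> \<in> ?A"
      then show "\<exists>n\<ge>m. prefix_of \<omega> n \<in> {u. M u < ereal a}" using liminf_less_frequently by blast
    next
      fix \<omega> n assume "\<omega> \<in> ?A"
      then obtain k where "k \<ge> n" "ereal b < M (prefix_of \<omega> k)" using limsup_greater_frequently by blast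
      then show "\<exists>k\<ge>n. ereal (b - c) \<le> M (prefix_of \<omega> k) - ereal c"
        by (intro exI[of _ k]) (cases "M (prefix_of \<omega> k)"; auto)
    qed (use ab True in auto)
  qed
qed

section \<open>The game-theoretic upper expectation satisfies the axioms\<close>

text \<open>
  Together with \<open>bsuper_EV\<close> this says that \<open>EV f\<close> is a martingale. One bets with the local model
  at \<open>s\<close> and then continues optimally, which is optional stopping after one step.
\<close>

lemma EV_le_upward_ext:
  assumes f: "\<And>\<omega>. ereal c \<le> f \<omega>"
  shows "EV f s \<le> upward_ext (Q s) (\<lambda>x. EV f (s @ [x]))"
proof -
  define E where "E = upward_ext (Q s) (\<lambda>x. EV f (s @ [x]))"
  define M where "M v = (if v = s then E else if prefix s v then EV f (s @ [v ! length s]) else \<infinity>)" for v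
  have c: "ereal c \<le> EV f v" for v using f by (intro EV_ge)
  have "bsuper M"
  proof (rule bsuperI)
    show "ereal c \<le> M v" for v using c upward_ext_ge[OF Q_coherent c] by (simp add: M_def E_def)
    fix v
    show "upward_ext (Q v) (\<lambda>x. M (v @ [x])) \<le> M v"
    proof (cases "prefix s v")
      case True
      have M_append: "M (v @ [x]) = (if v = s then EV f (s @ [x]) else M v)" for x
      proof (cases "v = s")
        case False
        then have "length s < length v" using True by (intro prefix_length_less) (simp add: strict_prefix_def)
        moreover from this have "v @ [x] \<noteq> s" by auto
        ultimately show ?thesis using True False by (simp add: M_def nth_append)
      qed (simp add: M_def)
      show ?thesis
      proof (cases "v = s")
        case True
        then show ?thesis using M_append by (simp add: M_def E_def)
      next
        case False
        then show ?thesis using M_append by (simp add: upward_ext_le[OF Q_coherent])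
      qed
    qed (auto simp: M_def)
  qed
  then have "EV f s \<le> M s"
  proof (rule EV_optional_stopping[OF _ f])
    fix \<omega> assume \<omega>: "\<omega> \<in> cylinder s"
    have "prefix_of \<omega> (Suc (length s)) = s @ [\<omega> (length s)]"
      using \<omega> by (simp add: prefix_of_Suc prefix_of_mem_cylinder)
    then have "EV f (prefix_of \<omega> (Suc (length s))) \<le> M (prefix_of \<omega> (Suc (length s)))"
      by (simp add: M_def)
    then show "f \<omega> \<le> liminf (\<lambda>n. M (prefix_of \<omega> n)) \<or>
        (\<exists>n\<ge>length s. EV f (prefix_of \<omega> n) \<le> M (prefix_of \<omega> n))"
      by (intro disjI2 exI[of _ "Suc (length s)"]) simp
  qed
  then show ?thesis by (simp add: M_def E_def)
qed

lemma EV_P1: "P1 Q EV"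
  unfolding P1_def
proof (intro allI)
  fix f :: "'x \<Rightarrow> real" and s :: "'x situation"
  let ?f = "\<lambda>\<omega>. ereal (f (\<omega> (length s)))"
  have b: "ereal (Min (range f)) \<le> ?f \<omega>" for \<omega> by simp
  have "EV ?f (s @ [x]) = ereal (f x)" for x
  proof (rule EV_const)
    fix \<omega> assume "\<omega> \<in> cylinder (s @ [x])"
    then have "\<omega> (length s) = (s @ [x]) ! length s" unfolding mem_cylinder_iff by simp
    then show "?f \<omega> = ereal (f x)" by simp
  qed
  then have "upward_ext (Q s) (\<lambda>x. EV ?f (s @ [x])) = Q s f" by (simp add: upward_ext_real[OF Q_coherent])
  moreover have "EV ?f s \<le> upward_ext (Q s) (\<lambda>x. EV ?f (s @ [x]))" by (rule EV_le_upward_ext) (rule b)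
  moreover have "upward_ext (Q s) (\<lambda>x. EV ?f (s @ [x])) \<le> EV ?f s" by (intro bsuperD bsuper_EV) (rule b)
  ultimately show "EV ?f s = Q s f" by simp
qed

lemma EV_P2: "P2 EV"
  unfolding P2_def by (intro ballI allI EV_cong) simp

lemma EV_P3: "P3 EV"
  unfolding P3_def
proof (intro ballI allI)
  fix f :: "'x global_variable" and n and \<omega> :: "'x path"
  assume "f \<in> finitary_gambles"
  then have "gamble f" by (simp add: finitary_gambles_def)
  from gamble_bounds[OF this] obtain c
    where c: "\<And>\<omega>. ereal (- c) \<le> f \<omega>" "\<And>\<omega>. f \<omega> \<le> ereal c" by metis
  define h where "h \<omega>' = EV f (prefix_of \<omega>' (n + 1))" for \<omega>'
  define s where "s = prefix_of \<omega> n"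
  have h: "ereal (- c) \<le> h \<omega>'" for \<omega>' unfolding h_def using c(1) by (intro EV_ge)
  have "EV f (s @ [x]) \<le> EV h (s @ [x])" for x
  proof (rule EV_ge)
    fix \<omega>' assume "\<omega>' \<in> cylinder (s @ [x])"
    then have "prefix_of \<omega>' (n + 1) = s @ [x]" by (auto simp: s_def dest: prefix_of_mem_cylinder)
    then show "EV f (s @ [x]) \<le> h \<omega>'" by (simp add: h_def)
  qed
  then have "upward_ext (Q s) (\<lambda>x. EV f (s @ [x])) \<le> upward_ext (Q s) (\<lambda>x. EV h (s @ [x]))" by (rule upward_ext_mono)
  then have "EV f s \<le> upward_ext (Q s) (\<lambda>x. EV h (s @ [x]))"
    by (rule order_trans[rotated]) (rule EV_le_upward_ext, rule c(1))
  also have "\<dots> \<le> EV h s" by (intro bsuperD bsuper_EV) (rule h)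
  finally have "EV f s \<le> EV h s" .
  then show "EV f (prefix_of \<omega> n) \<le> EV (\<lambda>\<omega>'. EV f (prefix_of \<omega>' (n + 1))) (prefix_of \<omega> n)"
    by (simp only: s_def h_def[abs_def])
qed

lemma EV_P4: "P4 EV"
  unfolding P4_def by (auto intro: EV_mono)

text \<open>
  The supremum \<open>L\<close> of the supermartingales \<open>EV (g k)\<close>, where \<open>g k\<close> is the infimum of the \<open>F j\<close> with
  \<open>j \<ge> k\<close>, is again a supermartingale. By the zero-one law its lower limit is at least every \<open>g k\<close>,
  and so at least \<open>f\<close>, outside the null set \<open>A\<close>; on \<open>A\<close> the term \<open>\<infinity> * indicator A\<close> takes over at
  no cost.
\<close>

lemma EV_fatou:
  assumes F: "\<And>n \<omega>. ereal c \<le> F n \<omega>" and lim: "\<And>\<omega>. f \<omega> \<le> liminf (\<lambda>n. F n \<omega>)"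
  shows "EV f s \<le> liminf (\<lambda>n. EV (F n) s)"
proof -
  define g where "g k \<omega> = (INF j\<in>{k..}. F j \<omega>)" for k \<omega>
  have g: "ereal c \<le> g k \<omega>" for k \<omega> unfolding g_def by (rule INF_greatest) (rule F)
  have gF: "g k \<omega> \<le> F j \<omega>" if "k \<le> j" for j k \<omega> unfolding g_def using that by (intro INF_lower) simp
  have g_inc: "g k \<omega> \<le> g l \<omega>" if "k \<le> l" for k l \<omega>
    unfolding g_def using that by (intro INF_superset_mono) auto
  define L where "L t = (SUP k. EV (g k) t)" for t
  have supL: "bsuper L"
    unfolding L_def by (intro bsuper_SUP bsuper_EV[OF g] incseq_SucI EV_mono g_inc) simp
  define A where "A = (\<Union>k. {\<omega>. liminf (\<lambda>n. EV (g k) (prefix_of \<omega> n)) < g k \<omega>})"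
  have "null A s" unfolding A_def by (intro null_UN EV_levy[OF g])
  have cL: "ereal c \<le> liminf (\<lambda>n. L (prefix_of \<omega> n))" for \<omega>
    unfolding L_def by (intro Liminf_bounded always_eventually allI SUP_upper2[of 0] EV_ge g) simp
  have "f \<omega> \<le> liminf (\<lambda>n. L (prefix_of \<omega> n)) + \<infinity> * indicator A \<omega>" for \<omega>
  proof (cases "\<omega> \<in> A")
    case True
    then show ?thesis using cL[of \<omega>] by auto
  next
    case False
    have "g k \<omega> \<le> liminf (\<lambda>n. L (prefix_of \<omega> n))" for k
    proof -
      have "g k \<omega> \<le> liminf (\<lambda>n. EV (g k) (prefix_of \<omega> n))" using False by (auto simp: A_def not_less)
      also have "\<dots> \<le> liminf (\<lambda>n. L (prefix_of \<omega> n))"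
        unfolding L_def by (intro Liminf_mono always_eventually allI SUP_upper) simp
      finally show ?thesis .
    qed
    then have "(SUP k. g k \<omega>) \<le> liminf (\<lambda>n. L (prefix_of \<omega> n))" by (intro SUP_least)
    then show ?thesis using lim[of \<omega>] False by (simp add: liminf_SUP_INF g_def)
  qed
  then have "EV f s \<le> EV (\<lambda>\<omega>. liminf (\<lambda>n. L (prefix_of \<omega> n)) + \<infinity> * indicator A \<omega>) s"
    by (rule EV_mono)
  also have "\<dots> \<le> EV (\<lambda>\<omega>. liminf (\<lambda>n. L (prefix_of \<omega> n))) s + EV (\<lambda>\<omega>. \<infinity> * indicator A \<omega>) s"
  proof (rule EV_add)
    show "ereal (min c 0) \<le> liminf (\<lambda>n. L (prefix_of \<omega> n))" for \<omega>
      by (rule order_trans[OF _ cL]) simp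
    show "ereal (min c 0) \<le> \<infinity> * indicator A \<omega>" for \<omega>
      by (rule order_trans[of _ "ereal 0"]) (auto simp: indicator_def zero_ereal_def[symmetric])
  qed
  also have "\<dots> \<le> L s + 0"
    using supL by (intro add_mono EV_infinity_null \<open>null A s\<close> EV_le[of L]) (auto simp: dominates_def)
  also have "L s + 0 \<le> liminf (\<lambda>n. EV (F n) s)"
  proof -
    have "EV (g k) s \<le> EV (F n) s" if "k \<le> n" for k n
      by (rule EV_mono) (rule gF[OF that])
    then have "EV (g k) s \<le> liminf (\<lambda>n. EV (F n) s)" for k
      by (intro Liminf_bounded) (auto simp: eventually_sequentially)
    then show ?thesis unfolding L_def by (simp add: SUP_least)
  qed
  finally show ?thesis .
qed

lemma EV_P5: "P5 EV"
  unfolding P5_def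
proof (intro allI impI, elim conjE exE)
  fix F :: "nat \<Rightarrow> 'x global_variable" and f s c
  assume F: "\<forall>n \<omega>. ereal c \<le> F n \<omega>" and lim: "\<forall>\<omega>. (\<lambda>n. F n \<omega>) \<longlonglongrightarrow> f \<omega>"
  have "EV f s \<le> liminf (\<lambda>n. EV (F n) s)"
  proof (rule EV_fatou)
    show "f \<omega> \<le> liminf (\<lambda>n. F n \<omega>)" for \<omega>
      using lim_imp_Liminf[OF trivial_limit_sequentially, of "\<lambda>n. F n \<omega>" "f \<omega>"] lim by simp
  qed (use F in blast)
  also have "\<dots> \<le> limsup (\<lambda>n. EV (F n) s)" by (simp add: Liminf_le_Limsup)
  finally show "EV f s \<le> limsup (\<lambda>n. EV (F n) s)" .
qed

section \<open>No axiomatic upper expectation is larger\<close>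

lemma Q_const: "Q s (\<lambda>_. r) = ereal r"
proof -
  have "Q s (\<lambda>_. r) = upward_ext (Q s) (\<lambda>_. ereal r)" by (simp add: upward_ext_real[OF Q_coherent])
  also have "\<dots> = ereal r" by (intro antisym upward_ext_le[OF Q_coherent] upward_ext_ge[OF Q_coherent]) auto
  finally show ?thesis .
qed

text \<open>
  On a situation that is long enough to determine \<open>G\<close>, the axioms P1 and P2 fix the value of \<open>E\<close>.
  For shorter situations, P3 and P4 reduce \<open>G\<close> to its conditional expectation one step later, which
  by P2 is a function of the next state, to which P1 applies.
\<close>

lemma axiomatic_le_EV_finitary:
  assumes E: "P1 Q E" "P2 E" "P3 E" "P4 E" and G: "G \<in> finitary_gambles"
  shows "E G s \<le> EV G s"
proof -
  have cong: "E f t = E g t"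
    if "f \<in> finitary_gambles" "g \<in> finitary_gambles" "\<And>\<omega>. \<omega> \<in> cylinder t \<Longrightarrow> f \<omega> = g \<omega>" for f g t
  proof -
    have "(\<lambda>\<omega>. f \<omega> * indicator (cylinder t) \<omega>) = (\<lambda>\<omega>. g \<omega> * indicator (cylinder t) \<omega>)"
      using that(3) by (auto simp: indicator_def)
    moreover have "E f t = E (\<lambda>\<omega>. f \<omega> * indicator (cylinder t) \<omega>) t"
      "E g t = E (\<lambda>\<omega>. g \<omega> * indicator (cylinder t) \<omega>) t"
      using E(2) that(1,2) unfolding P2_def by blast+
    ultimately show ?thesis by simp
  qed
  obtain n where n: "n_measurable n G" using G by (auto simp: finitary_gambles_def finitary_def)
  have "gamble G" using G by (simp add: finitary_gambles_def)
  from gamble_bounds[OF this] obtain c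
    where c: "\<And>\<omega>. ereal (- c) \<le> G \<omega>" "\<And>\<omega>. G \<omega> \<le> ereal c" by metis
  have Ec: "ereal (- c) \<le> EV G t" "EV G t \<le> ereal c" for t
    by (rule EV_ge, rule c(1)) (rule EV_const_le, rule c(2))
  \<comment> \<open>Backward induction: \<open>k\<close> bounds the number of steps that still have to be observed.\<close>
  have "n \<le> length s + k \<Longrightarrow> E G s \<le> EV G s" for k
  proof (induction k arbitrary: s)
    case 0
    obtain \<omega>0 where \<omega>0: "\<omega>0 \<in> cylinder s" using cylinder_nonempty by blast
    define r where "r = real_of_ereal (G \<omega>0)"
    have "G \<omega>0 = ereal r" using c[of \<omega>0] unfolding r_def by (cases "G \<omega>0") auto
    then have r: "G \<omega> = ereal r" if "\<omega> \<in> cylinder s" for \<omega>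
      using n_measurable_cylinder[OF n _ that \<omega>0] 0 by simp
    have "E G s = E (\<lambda>_. ereal r) s"
    proof (rule cong)
      show "(\<lambda>_. ereal r) \<in> finitary_gambles"
        by (rule finitary_gambleI[of 0 _ "\<bar>r\<bar>"]) (auto simp: n_measurable_def)
    qed (use r G in auto)
    also have "\<dots> = Q s (\<lambda>_. r)" using E(1)[unfolded P1_def, rule_format, of "\<lambda>_. r" s] by simp
    also have "\<dots> = ereal r" by (rule Q_const)
    also have "\<dots> \<le> EV G s" by (rule EV_ge) (simp add: r)
    finally show ?case .
  next
    case (Suc k)
    define H where "H \<omega> = EV G (prefix_of \<omega> (length s + 1))" for \<omega>
    define g where "g x = real_of_ereal (EV G (s @ [x]))" for x
    have g: "ereal (g x) = EV G (s @ [x])" for x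
      using Ec[of "s @ [x]"] unfolding g_def by (cases "EV G (s @ [x])") auto
    obtain \<omega>0 where \<omega>0: "\<omega>0 \<in> cylinder s" using cylinder_nonempty by blast
    have "E G s \<le> E (\<lambda>\<omega>. E G (prefix_of \<omega> (length s + 1))) s"
      using E(3)[unfolded P3_def, rule_format, OF G, of \<omega>0 "length s"] prefix_of_mem_cylinder[OF \<omega>0] by simp
    also have "\<dots> \<le> E H s"
    proof (rule E(4)[unfolded P4_def, rule_format])
      show "E G (prefix_of \<omega> (length s + 1)) \<le> H \<omega>" for \<omega>
        unfolding H_def by (rule Suc.IH) (use Suc.prems in simp)
    qed
    also have "\<dots> = E (\<lambda>\<omega>. ereal (g (\<omega> (length s)))) s"
    proof (rule cong)
      show "H \<in> finitary_gambles"
      proof (rule finitary_gambleI)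
        show "n_measurable (length s + 1) H" by (simp add: n_measurable_def H_def)
        show "ereal (- c) \<le> H \<omega>" "H \<omega> \<le> ereal c" for \<omega> unfolding H_def by (rule Ec)+
      qed
      show "(\<lambda>\<omega>. ereal (g (\<omega> (length s)))) \<in> finitary_gambles"
      proof (intro finitary_gambleI[of "length s + 1" _ c])
        show "n_measurable (length s + 1) (\<lambda>\<omega>. ereal (g (\<omega> (length s))))"
          unfolding n_measurable_def by (auto simp: prefix_of_Suc)
        show "ereal (- c) \<le> ereal (g (\<omega> (length s)))" "ereal (g (\<omega> (length s))) \<le> ereal c" for \<omega>
          unfolding g by (rule Ec)+
      qed
      show "H \<omega> = ereal (g (\<omega> (length s)))" if "\<omega> \<in> cylinder s" for \<omega>
        using that by (simp add: H_def g prefix_of_Suc prefix_of_mem_cylinder)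
    qed
    also have "\<dots> = Q s g" using E(1)[unfolded P1_def, rule_format, of g s] by simp
    also have "\<dots> = upward_ext (Q s) (\<lambda>x. EV G (s @ [x]))" using upward_ext_real[OF Q_coherent, of s g] by (simp add: g)
    also have "\<dots> \<le> EV G s" by (intro bsuperD bsuper_EV) (rule c(1))
    finally show ?case .
  qed
  from this[of n] show ?thesis by simp
qed

text \<open>
  Let \<open>A\<close> be the null set of paths on which \<open>M\<close> does not converge. Supermartingales \<open>T m\<close> of
  initial value below \<open>e / 2 * (1 / 2) ^ Suc m\<close> dominate its indicator. The gamble \<open>V n\<close> counts the
  indices \<open>m < n\<close> for which \<open>T m\<close> has exceeded \<open>1 / 2\<close> between \<open>s\<close> and time \<open>n\<close>. Being increasing in \<open>n\<close>, it
  converges on every path; it tends to infinity on \<open>A\<close>; and its upper expectation is at most \<open>e\<close>,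
  since by optional stopping \<open>T m\<close> exceeds \<open>1 / 2\<close> with upper probability at most \<open>2 * T m s\<close>.
  Therefore \<open>min (M (prefix_of \<omega> n)) n + V n \<omega>\<close> converges everywhere on the cylinder of \<open>s\<close>, to a
  limit above \<open>f \<omega>\<close>.
\<close>

lemma finitary_approximation:
  assumes M: "bsuper M" and dom: "dominates M s f" and e: "0 < e"
  obtains G g c where "\<And>n. G n \<in> finitary_gambles" "\<And>n \<omega>. ereal c \<le> G n \<omega>"
    "\<And>\<omega>. (\<lambda>n. G n \<omega>) \<longlonglongrightarrow> g \<omega>" "\<And>\<omega>. f \<omega> \<le> g \<omega>"
    "\<And>n. length s \<le> n \<Longrightarrow> EV (G n) s \<le> M s + ereal e"
proof -
  obtain c where c: "\<And>t. ereal c \<le> M t" using bsuper_bound M by metis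
  define A where "A = {\<omega>. liminf (\<lambda>n. M (prefix_of \<omega> n)) < limsup (\<lambda>n. M (prefix_of \<omega> n))}"
  have A: "null A s" unfolding A_def by (rule bsuper_converges[OF M])
  have "\<exists>T. bsuper T \<and> dominates T s (indicator A) \<and> T s < ereal (e / 2 * (1 / 2) ^ Suc m) \<and> (\<forall>t. 0 \<le> T t)" for m
  proof -
    have "EV (indicator A) s < ereal (e / 2 * (1 / 2) ^ Suc m)"
      using e by (intro le_less_trans[OF A]) auto
    moreover have "ereal 0 \<le> indicator A \<omega>" for \<omega> by (simp add: indicator_def)
    ultimately obtain T where "bsuper T" "dominates T s (indicator A)"
      "T s < ereal (e / 2 * (1 / 2) ^ Suc m)" "\<And>t. ereal 0 \<le> T t"
      using EV_witness[of 0 "indicator A" s] by metis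
    then show ?thesis by (auto simp: zero_ereal_def)
  qed
  then obtain T where T: "\<And>m. bsuper (T m)" "\<And>m. dominates (T m) s (indicator A)"
    "\<And>m. T m s < ereal (e / 2 * (1 / 2) ^ Suc m)" "\<And>m t. 0 \<le> T m t"
    by metis
  define C where "C m n = {\<omega>. \<exists>j. length s \<le> j \<and> j \<le> n \<and> ereal (1 / 2) < T m (prefix_of \<omega> j)}" for m n
  define V where "V n \<omega> = (\<Sum>m<n. indicator (C m n) \<omega> :: real)" for n \<omega>
  have V: "0 \<le> V n \<omega>" "V n \<omega> \<le> real n" for n \<omega>
    using sum_bounded_above[of "{..<n}" "\<lambda>m. indicator (C m n) \<omega> :: real" 1]
    by (auto simp: V_def sum_nonneg indicator_le_1)
  have V_inc: "incseq (\<lambda>n. V n \<omega>)" for \<omega>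
  proof (rule incseq_SucI)
    fix n
    have "V n \<omega> \<le> (\<Sum>m<n. indicator (C m (Suc n)) \<omega>)"
      unfolding V_def by (intro sum_mono) (auto simp: indicator_def C_def)
    then show "V n \<omega> \<le> V (Suc n) \<omega>" unfolding V_def by (simp add: add_increasing2)
  qed
  \<comment> \<open>P2 speaks of finitary gambles only, so \<open>f\<close> must be dominated outside the cylinder as well;
    the values there do not affect \<open>EV (G n) s\<close>.\<close>
  define G where "G n \<omega> = (if \<omega> \<in> cylinder s
    then min (M (prefix_of \<omega> n)) (ereal (real n)) + ereal (V n \<omega>) else ereal (real n))" for n \<omega>
  have min_ge: "ereal (min c 0) \<le> min (M t) (ereal (real n))" for t n
    using c[of t] order_trans[of "ereal (min c 0)" "ereal c"] by (auto simp del: ereal_min)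
  have G_ge: "ereal (min c 0) + ereal (V n \<omega>) \<le> min (M (prefix_of \<omega> n)) (ereal (real n)) + ereal (V n \<omega>)" for n \<omega>
    using min_ge by (rule add_right_mono)
  have G_lower: "ereal (min c 0) \<le> G n \<omega>" for n \<omega>
    unfolding G_def using V(1)[of n \<omega>] min_ge by (auto simp del: ereal_min intro: add_increasing2 order_trans[OF _ G_ge])
  show thesis
  proof (rule that[of G "min c 0"  "\<lambda>\<omega>. lim (\<lambda>n. G n \<omega>)"])
    show "G n \<in> finitary_gambles" for n
    proof (rule finitary_gambleI[of "max n (length s)" _ "\<bar>c\<bar> + 2 * real n"])
      show "n_measurable (max n (length s)) (G n)"
        unfolding n_measurable_def
      proof (intro allI impI)
        fix \<omega> \<omega>' :: "'x path" assume eq: "prefix_of \<omega> (max n (length s)) = prefix_of \<omega>' (max n (length s))"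
        have pre: "prefix_of \<omega> j = prefix_of \<omega>' j" if "j \<le> max n (length s)" for j
          using arg_cong[OF eq, of "take j"] that by (simp only: take_prefix_of min_absorb1)
        have "\<omega> \<in> cylinder s \<longleftrightarrow> \<omega>' \<in> cylinder s" using pre[of "length s"] by (simp add: cylinder_def)
        moreover have "\<omega> \<in> C m n \<longleftrightarrow> \<omega>' \<in> C m n" for m using pre unfolding C_def by auto
        then have "V n \<omega> = V n \<omega>'" by (simp add: V_def indicator_def)
        ultimately show "G n \<omega> = G n \<omega>'" using pre[of n] by (simp add: G_def)
      qed
      show "ereal (- (\<bar>c\<bar> + 2 * real n)) \<le> G n \<omega>" for \<omega>
        by (rule order_trans[OF _ G_lower]) (simp add: min_def)
      have "min (M (prefix_of \<omega> n)) (ereal (real n)) + ereal (V n \<omega>) \<le> ereal (real n) + ereal (real n)" for \<omega>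
        using V(2)[of n \<omega>] by (intro add_mono) auto
      then have "min (M (prefix_of \<omega> n)) (ereal (real n)) + ereal (V n \<omega>) \<le> ereal (\<bar>c\<bar> + 2 * real n)" for \<omega>
        by (rule order_trans) simp
      then show "G n \<omega> \<le> ereal (\<bar>c\<bar> + 2 * real n)" for \<omega>
        by (simp add: G_def)
    qed
    show "ereal (min c 0) \<le> G n \<omega>" for n \<omega> by (rule G_lower)
    have n_lim: "(\<lambda>n. ereal (real n)) \<longlonglongrightarrow> \<infinity>" by (rule id_nat_ereal_tendsto_PInf)
    have "\<exists>l. (\<lambda>n. G n \<omega>) \<longlonglongrightarrow> l \<and> f \<omega> \<le> l" for \<omega>
    proof (cases "\<omega> \<in> cylinder s")
      case False
      then show ?thesis using n_lim by (intro exI[of _ \<infinity>]) (simp add: G_def)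
    next
      case \<omega>: True
      show ?thesis
      proof (cases "\<omega> \<in> A")
        case True
        have "(\<lambda>n. G n \<omega>) \<longlonglongrightarrow> \<infinity>" unfolding tendsto_PInfty
        proof
          fix r :: real
          obtain K :: nat where K: "r - min c 0 < real K" using reals_Archimedean2 by blast
          have "\<exists>j\<ge>length s. ereal (1 / 2) < T m (prefix_of \<omega> j)" for m
          proof -
            have "1 \<le> liminf (\<lambda>j. T m (prefix_of \<omega> j))"
              using T(2)[of m] \<omega> True by (auto simp: dominates_def indicator_def split: if_splits)
            then have "ereal (1 / 2) < liminf (\<lambda>j. T m (prefix_of \<omega> j))"
              by (rule less_le_trans[rotated]) (simp add: one_ereal_def)
            from less_LiminfD[OF this] show ?thesis
              unfolding eventually_sequentially by (meson nat_le_linear)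
          qed
          then obtain j where j: "\<And>m. length s \<le> j m" "\<And>m. ereal (1 / 2) < T m (prefix_of \<omega> (j m))" by metis
          define N where "N = max K (Max (j ` {..K}))"
          have "ereal r < G n \<omega>" if n: "N \<le> n" for n
          proof -
            have "\<omega> \<in> C m n" if "m < K" for m
            proof -
              have "j m \<le> Max (j ` {..K})" using that by (intro Max_ge) auto
              also have "\<dots> \<le> n" by (rule order_trans[OF max.cobounded2 n[unfolded N_def]])
              finally show ?thesis using j[of m] unfolding C_def by blast
            qed
            then have "(\<Sum>m<K. indicator (C m n) \<omega> :: real) = real K" by simp
            moreover have "(\<Sum>m<K. indicator (C m n) \<omega> :: real) \<le> V n \<omega>"
              unfolding V_def using n by (intro sum_mono2) (auto simp: N_def)
            ultimately have "r < min c 0 + V n \<omega>" using K by simp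
            then have "ereal r < ereal (min c 0) + ereal (V n \<omega>)" by (simp del: ereal_min)
            also have "\<dots> \<le> G n \<omega>" using G_ge \<omega> by (simp add: G_def)
            finally show ?thesis .
          qed
          then show "\<forall>\<^sub>F n in sequentially. ereal r < G n \<omega>" by (auto simp: eventually_sequentially)
        qed
        then show ?thesis by (intro exI[of _ \<infinity>]) simp
      next
        case False
        define x where "x = liminf (\<lambda>n. M (prefix_of \<omega> n))"
        have "limsup (\<lambda>n. M (prefix_of \<omega> n)) = x"
          using False Liminf_le_Limsup[of sequentially "\<lambda>n. M (prefix_of \<omega> n)"] by (auto simp: A_def x_def not_less)
        then have Mx: "(\<lambda>n. M (prefix_of \<omega> n)) \<longlonglongrightarrow> x"
          by (intro Liminf_eq_Limsup) (auto simp: x_def)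
        have cx: "ereal c \<le> x" unfolding x_def by (intro Liminf_bounded always_eventually allI c)
        define L where "L = (SUP n. ereal (V n \<omega>))"
        have VL: "(\<lambda>n. ereal (V n \<omega>)) \<longlonglongrightarrow> L"
          unfolding L_def using V_inc[of \<omega>] by (intro LIMSEQ_SUP) (auto simp: incseq_def)
        have L0: "0 \<le> L" unfolding L_def using V by (intro SUP_upper2[of 0]) auto
        have "(\<lambda>n. min (M (prefix_of \<omega> n)) (ereal (real n)) + ereal (V n \<omega>)) \<longlonglongrightarrow> min x \<infinity> + L"
          using cx L0 by (intro tendsto_add_ereal_nonneg tendsto_min Mx n_lim VL) auto
        then have "(\<lambda>n. G n \<omega>) \<longlonglongrightarrow> x + L" using \<omega> by (simp add: G_def)
        moreover have "f \<omega> \<le> x + L"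
          using dom \<omega> L0 unfolding dominates_def x_def by (simp add: add_increasing2)
        ultimately show ?thesis by blast
      qed
    qed
    then show "(\<lambda>n. G n \<omega>) \<longlonglongrightarrow> lim (\<lambda>n. G n \<omega>)" "f \<omega> \<le> lim (\<lambda>n. G n \<omega>)" for \<omega>
      using limI by metis+
    fix n assume n: "length s \<le> n"
    have 1: "EV (\<lambda>\<omega>. min (M (prefix_of \<omega> n)) (ereal (real n))) s \<le> M s"
    proof (rule EV_optional_stopping[OF M min_ge], rule disjI2, intro exI conjI)
      show "length s \<le> n" by fact
      fix \<omega>
      show "EV (\<lambda>\<omega>. min (M (prefix_of \<omega> n)) (ereal (real n))) (prefix_of \<omega> n) \<le> M (prefix_of \<omega> n)"
      proof (cases "M (prefix_of \<omega> n)")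
        case (real r)
        then have "EV (\<lambda>\<omega>. min (M (prefix_of \<omega> n)) (ereal (real n))) (prefix_of \<omega> n) \<le> ereal r"
          by (intro EV_const_le) (auto simp: cylinder_def)
        then show ?thesis using real by simp
      qed (use c[of "prefix_of \<omega> n"] in auto)
    qed
    have C: "EV (indicator (C m n)) s \<le> ereal (e * (1 / 2) ^ Suc m)" for m
    proof -
      have "EV (indicator (C m n)) s \<le> ereal 2 * T m s"
      proof (rule EV_optional_stopping[OF bsuper_cmult[OF T(1)], of _ 0])
        fix \<omega>
        show "indicator (C m n) \<omega> \<le> liminf (\<lambda>k. ereal 2 * T m (prefix_of \<omega> k)) \<or>
          (\<exists>k\<ge>length s. EV (indicator (C m n)) (prefix_of \<omega> k) \<le> ereal 2 * T m (prefix_of \<omega> k))"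
        proof (cases "\<omega> \<in> C m n")
          case True
          then obtain j where j: "length s \<le> j" "ereal (1 / 2) < T m (prefix_of \<omega> j)" by (auto simp: C_def)
          have "EV (indicator (C m n)) (prefix_of \<omega> j) \<le> ereal 1"
            by (rule EV_const_le) (auto simp: indicator_def)
          also have "\<dots> \<le> ereal 2 * ereal (1 / 2)" by simp
          also have "\<dots> \<le> ereal 2 * T m (prefix_of \<omega> j)"
            using j by (intro ereal_mult_left_mono) auto
          finally show ?thesis using j by blast
        next
          case False
          have "0 \<le> liminf (\<lambda>k. ereal 2 * T m (prefix_of \<omega> k))"
            using T(4) by (intro Liminf_bounded always_eventually) auto
          then show ?thesis using False by simp
        qed
      qed (auto simp: zero_ereal_def[symmetric])
      also have "\<dots> \<le> ereal 2 * ereal (e / 2 * (1 / 2) ^ Suc m)"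
        using T(3)[of m] by (intro ereal_mult_left_mono) auto
      finally show ?thesis by simp
    qed
    have "EV (\<lambda>\<omega>. ereal (\<Sum>m<k. indicator (C m n) \<omega>)) s \<le> ereal (e - e * (1 / 2) ^ k)" for k
    proof (induction k)
      case 0
      then show ?case using EV_const_le[of s "\<lambda>_. 0" 0] by (simp add: zero_ereal_def)
    next
      case (Suc k)
      have ind: "ereal (indicator (C k n) \<omega>) = indicator (C k n) \<omega>" for \<omega> by (simp add: indicator_def)
      have "EV (\<lambda>\<omega>. ereal (\<Sum>m<k. indicator (C m n) \<omega>) + indicator (C k n) \<omega>) s
        \<le> EV (\<lambda>\<omega>. ereal (\<Sum>m<k. indicator (C m n) \<omega>)) s + EV (indicator (C k n)) s"
        by (rule EV_add[of 0]) (auto simp: sum_nonneg zero_ereal_def[symmetric])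
      also have "\<dots> \<le> ereal (e - e * (1 / 2) ^ k) + ereal (e * (1 / 2) ^ Suc k)"
        by (rule add_mono[OF Suc C])
      also have "\<dots> = ereal (e - e * (1 / 2) ^ Suc k)" by simp
      finally show ?case by (simp flip: ind)
    qed
    from this[of n] have 2: "EV (\<lambda>\<omega>. ereal (V n \<omega>)) s \<le> ereal e"
      unfolding V_def by (rule order_trans) (use e in simp)
    have "EV (G n) s = EV (\<lambda>\<omega>. min (M (prefix_of \<omega> n)) (ereal (real n)) + ereal (V n \<omega>)) s"
      by (rule EV_cong) (simp add: G_def)
    also have "\<dots> \<le> EV (\<lambda>\<omega>. min (M (prefix_of \<omega> n)) (ereal (real n))) s + EV (\<lambda>\<omega>. ereal (V n \<omega>)) s"
    proof (rule EV_add[OF min_ge])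
      show "ereal (min c 0) \<le> ereal (V n \<omega>)" for \<omega> using V(1)[of n \<omega>] by (simp del: ereal_min)
    qed
    also have "\<dots> \<le> M s + ereal e" by (rule add_mono[OF 1 2])
    finally show "EV (G n) s \<le> M s + ereal e" .
  qed
qed

lemma axiomatic_le_EV:
  assumes E: "P1 Q E" "P2 E" "P3 E" "P4 E" "P5 E"
  shows "E f s \<le> EV f s"
proof (rule EV_greatest)
  fix M assume M: "bsuper M" "dominates M s f"
  show "E f s \<le> M s"
  proof (rule ereal_le_epsilon2)
    fix e :: real assume "0 < e"
    then obtain G g c where G: "\<And>n. G n \<in> finitary_gambles" "\<And>n \<omega>. ereal c \<le> G n \<omega>"
      "\<And>\<omega>. (\<lambda>n. G n \<omega>) \<longlonglongrightarrow> g \<omega>" "\<And>\<omega>. f \<omega> \<le> g \<omega>"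
      "\<And>n. length s \<le> n \<Longrightarrow> EV (G n) s \<le> M s + ereal e"
      using finitary_approximation[OF M] by metis
    have "E f s \<le> E g s" using E(4) G(4) unfolding P4_def by blast
    also have "\<dots> \<le> limsup (\<lambda>n. E (G n) s)" using E(5) G(1-3) unfolding P5_def by blast
    also have "\<dots> \<le> M s + ereal e"
    proof (rule Limsup_bounded)
      have "E (G n) s \<le> M s + ereal e" if "length s \<le> n" for n
        using axiomatic_le_EV_finitary[OF E(1-4) G(1)] G(5)[OF that] by (rule order_trans)
      then show "\<forall>\<^sub>F n in sequentially. E (G n) s \<le> M s + ereal e" by (auto simp: eventually_sequentially)
    qed
    finally show "E f s \<le> M s + ereal e" .
  qed
qed

lemma E_A_eq_E_V: "E_A Q = E_V Q"
  unfolding E_A_def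
proof (rule Greatest_equality)
  show "P1 Q EV \<and> P2 EV \<and> P3 EV \<and> P4 EV \<and> P5 EV"
    by (intro conjI EV_P1 EV_P2 EV_P3 EV_P4 EV_P5)
  show "E \<le> EV" if "P1 Q E \<and> P2 E \<and> P3 E \<and> P4 E \<and> P5 E" for E
    unfolding le_fun_def using that axiomatic_le_EV by blast
qed

end

section \<open>The path measure of a precise probability tree\<close>

lemma path_algebra_simps [simp]: "space path_algebra = UNIV" "cylinder z \<in> sets path_algebra"
  by (auto simp: path_algebra_def)

lemma cylinder_Nil [simp]: "cylinder [] = UNIV"
  by (simp add: cylinder_def prefix_of_def)

lemma prod_of_bool_nth_eq:
  assumes "n \<le> length z" "n \<le> length s"
  shows "(\<Prod>i<n. of_bool (z ! i = s ! i) :: real) = of_bool (take n z = take n s)"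
proof -
  have "take n z = take n s \<longleftrightarrow> (\<forall>i<n. z ! i = s ! i)"
    using assms by (auto simp: list_eq_iff_nth_eq)
  then show ?thesis by (induction n) (auto simp: less_Suc_eq)
qed

text \<open>
  Conditioning on \<open>s\<close> amounts to replacing the local probabilities along \<open>s\<close> by point masses. This
  turns the three cases of \<open>cylinder_prob\<close> into a single product.
\<close>

lemma cylinder_prob_prod:
  "(\<Prod>i<length z. pmf (if i < length s then return_pmf (s ! i) else p (take i z)) (z ! i))
    = cylinder_prob p s z"
proof (cases "length z \<le> length s")
  case True
  have "(\<Prod>i<length z. pmf (if i < length s then return_pmf (s ! i) else p (take i z)) (z ! i))
      = (\<Prod>i<length z. of_bool (z ! i = s ! i))"
    using True by (intro prod.cong) (auto simp: pmf_return)
  also have "\<dots> = of_bool (take (length z) z = take (length z) s)"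
    using True by (intro prod_of_bool_nth_eq) auto
  finally show ?thesis using True by (auto simp: cylinder_prob_def)
next
  case False
  let ?f = "\<lambda>i. pmf (if i < length s then return_pmf (s ! i) else p (take i z)) (z ! i)"
  have "(\<Prod>i<length z. ?f i) = (\<Prod>i<length s. ?f i) * (\<Prod>i=length s..<length z. ?f i)"
    unfolding lessThan_atLeast0 using False by (intro prod.atLeastLessThan_concat[symmetric]) auto
  also have "(\<Prod>i<length s. ?f i) = (\<Prod>i<length s. of_bool (z ! i = s ! i))"
    by (intro prod.cong) (auto simp: pmf_return)
  also have "\<dots> = of_bool (take (length s) z = take (length s) s)"
    using False by (intro prod_of_bool_nth_eq) auto
  also have "(\<Prod>i=length s..<length z. ?f i) = (\<Prod>i=length s..<length z. pmf (p (take i z)) (z ! i))"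
    by (intro prod.cong) auto
  finally show ?thesis using False by (auto simp: cylinder_prob_def)
qed

text \<open>
  Draw a successor of every situation independently and follow the drawn successors. The path lies
  in the cylinder of \<open>z\<close> if and only if the draws at the proper prefixes of \<open>z\<close> are the states of
  \<open>z\<close>; these prefixes are distinct, so the probability is the product of the local ones.
\<close>

lemma path_measure_exists:
  fixes p :: "'x::finite precise_tree"
  shows "\<exists>P. prob_space P \<and> sets P = sets path_algebra \<and>
     (\<forall>z. measure P (cylinder z) = cylinder_prob p s z)"
proof -
  define p' where "p' t = (if length t < length s then return_pmf (s ! length t) else p t)" for t
  define D where "D = (\<Pi>\<^sub>M t\<in>UNIV. measure_pmf (p' t))"
  interpret D: prob_space D unfolding D_def by (intro prob_space_PiM measure_pmf.prob_space_axioms)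
  define J where "J z = (\<lambda>i. take i z) ` {..<length z}" for z :: "'x situation"
  have vimage: "follow -` cylinder z \<inter> space D =
    prod_emb UNIV (\<lambda>t. measure_pmf (p' t)) (J z) (\<Pi>\<^sub>E t\<in>J z. {z ! length t})" for z
    by (auto simp: D_def prod_emb_def space_PiM follow_mem_cylinder_iff J_def PiE_iff extensional_def restrict_def)
  have sets: "follow -` cylinder z \<inter> space D \<in> sets D" for z
    unfolding vimage unfolding D_def by (intro sets_PiM_I) (auto simp: J_def)
  have meas: "follow \<in> measurable D path_algebra"
    unfolding path_algebra_def by (rule measurable_measure_of) (use sets in auto)
  define P where "P = distr D path_algebra follow"
  have "measure P (cylinder z) = cylinder_prob p s z" for z
  proof -
    have inj: "inj_on (\<lambda>i. take i z) {..<length z}"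
      by (auto simp: inj_on_def dest: arg_cong[of _ _ length])
    have "emeasure P (cylinder z) = emeasure D (follow -` cylinder z \<inter> space D)"
      unfolding P_def by (rule emeasure_distr[OF meas]) simp
    also have "\<dots> = (\<Prod>t\<in>J z. emeasure (measure_pmf (p' t)) {z ! length t})"
      unfolding vimage unfolding D_def
      by (rule emeasure_PiM_emb) (auto simp: J_def measure_pmf.prob_space_axioms)
    also have "\<dots> = (\<Prod>i<length z. ennreal (pmf (p' (take i z)) (z ! i)))"
      unfolding J_def using inj by (simp add: prod.reindex emeasure_pmf_single)
    also have "\<dots> = ennreal (\<Prod>i<length z. pmf (p' (take i z)) (z ! i))"
      by (simp add: prod_ennreal)
    also have "(\<Prod>i<length z. pmf (p' (take i z)) (z ! i)) = cylinder_prob p s z"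
      unfolding cylinder_prob_prod[symmetric] by (intro prod.cong) (auto simp: p'_def)
    finally have "emeasure P (cylinder z) = ennreal (cylinder_prob p s z)" .
    moreover have "0 \<le> cylinder_prob p s z"
      unfolding cylinder_prob_prod[symmetric] by (intro prod_nonneg) auto
    ultimately show ?thesis by (simp add: measure_def)
  qed
  moreover have "prob_space P" unfolding P_def by (rule D.prob_space_distr[OF meas])
  moreover have "sets P = sets path_algebra" by (simp add: P_def)
  ultimately show ?thesis by blast
qed

lemma cylinder_Int:
  "cylinder s \<inter> cylinder t = (if prefix s t then cylinder t else if prefix t s then cylinder s else {})"
proof -
  have "prefix s t \<or> prefix t s" if "\<omega> \<in> cylinder s" "\<omega> \<in> cylinder t" for \<omega>
    using that by (metis nat_le_linear prefix_of_mem_cylinder prefix_prefix_of_iff)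
  then show ?thesis using cylinder_antimono[of s t] cylinder_antimono[of t s] by auto
qed

lemma path_measure_unique:
  assumes P: "prob_space P" "sets P = sets path_algebra"
    and P': "prob_space P'" "sets P' = sets path_algebra"
    and eq: "\<And>z. measure P (cylinder z) = measure P' (cylinder z)"
  shows "P = P'"
proof (rule measure_eqI_generator_eq)
  let ?E = "insert {} (range cylinder)"
  interpret P: prob_space P by fact
  interpret P': prob_space P' by fact
  show "Int_stable ?E" by (auto simp: Int_stable_def cylinder_Int)
  show "?E \<subseteq> Pow UNIV" by simp
  show "emeasure P X = emeasure P' X" if "X \<in> ?E" for X
    using that eq by (auto simp: P.emeasure_eq_measure P'.emeasure_eq_measure)
  have "sets path_algebra = sigma_sets UNIV (range cylinder)" by (simp add: path_algebra_def)
  also have "\<dots> = sigma_sets UNIV ?E"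
  proof (rule antisym)
    show "sigma_sets UNIV (range cylinder) \<subseteq> sigma_sets UNIV ?E" by (rule sigma_sets_mono') auto
    show "sigma_sets UNIV ?E \<subseteq> sigma_sets UNIV (range cylinder)"
      by (rule sigma_sets_mono) (auto intro: sigma_sets.Empty sigma_sets.Basic)
  qed
  finally show "sets P = sigma_sets UNIV ?E" "sets P' = sigma_sets UNIV ?E" using P P' by auto
  show "range (\<lambda>_::nat. cylinder []) \<subseteq> ?E" by (rule image_subsetI) blast
  show "(\<Union>i::nat. cylinder []) = UNIV" by simp
  show "emeasure P (cylinder []) \<noteq> \<infinity>" by (simp add: P.emeasure_eq_measure)
qed

lemma path_measure:
  fixes p :: "'x::finite precise_tree"
  shows prob_space_path_measure: "prob_space (path_measure p s)"
    and sets_path_measure: "sets (path_measure p s) = sets path_algebra"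
    and measure_path_measure: "measure (path_measure p s) (cylinder z) = cylinder_prob p s z"
proof -
  let ?P = "\<lambda>P. prob_space P \<and> sets P = sets path_algebra \<and>
     (\<forall>z. measure P (cylinder z) = cylinder_prob p s z)"
  obtain P where P: "?P P" using path_measure_exists by blast
  have "path_measure p s = P"
    unfolding path_measure_def
  proof (rule the_equality)
    show "P' = P" if "?P P'" for P'
      by (rule path_measure_unique) (use P that in auto)
  qed (rule P)
  then have "?P (path_measure p s)" using P by simp
  then show "prob_space (path_measure p s)" "sets (path_measure p s) = sets path_algebra"
    "measure (path_measure p s) (cylinder z) = cylinder_prob p s z" by auto
qed

section \<open>The measure-theoretic upper expectation\<close>

lemma measurable_prefix_of:
  fixes k :: "'x::finite situation \<Rightarrow> 'b"
  assumes "\<And>t. k t \<in> space N"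
  shows "(\<lambda>\<omega>. k (prefix_of \<omega> n)) \<in> measurable path_algebra N"
proof (rule measurable_compose[of "\<lambda>\<omega>. prefix_of \<omega> n" _ "count_space UNIV"])
  show "(\<lambda>\<omega>. prefix_of \<omega> n :: 'x situation) \<in> measurable path_algebra (count_space UNIV)"
  proof (rule measurable_count_space_eq2_countable[THEN iffD2], intro conjI ballI)
    fix z :: "'x situation"
    have "(\<lambda>\<omega>. prefix_of \<omega> n) -` {z} \<inter> space path_algebra = (if length z = n then cylinder z else {})"
      by (auto simp: cylinder_def)
    then show "(\<lambda>\<omega>. prefix_of \<omega> n) -` {z} \<inter> space path_algebra \<in> sets path_algebra" by simp
  qed auto
  show "k \<in> measurable (count_space UNIV) N" using assms by simp
qed

lemma nn_integral_prefix_of: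
  fixes k :: "'x::finite situation \<Rightarrow> ennreal"
  shows "(\<integral>\<^sup>+ \<omega>. k (prefix_of \<omega> n) \<partial>path_measure p s)
    = (\<Sum>z\<in>{z. length z = n}. k z * ennreal (cylinder_prob p s z))"
proof -
  interpret P: prob_space "path_measure p s" by (rule prob_space_path_measure)
  have fin: "finite {z :: 'x situation. length z = n}"
    using finite_lists_length_eq[of "UNIV :: 'x set" n] by simp
  have "k (prefix_of \<omega> n) = (\<Sum>z\<in>{z. length z = n}. k z * indicator (cylinder z) \<omega>)" for \<omega>
  proof -
    have "(\<Sum>z\<in>{z. length z = n}. k z * indicator (cylinder z) \<omega>)
        = (\<Sum>z\<in>{z. length z = n}. if z = prefix_of \<omega> n then k z else 0)"
      by (intro sum.cong) (auto simp: indicator_def cylinder_def)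
    also have "\<dots> = k (prefix_of \<omega> n)" using fin by simp
    finally show ?thesis by simp
  qed
  then have "(\<integral>\<^sup>+ \<omega>. k (prefix_of \<omega> n) \<partial>path_measure p s)
    = (\<integral>\<^sup>+ \<omega>. (\<Sum>z\<in>{z. length z = n}. k z * indicator (cylinder z) \<omega>) \<partial>path_measure p s)"
    by (intro nn_integral_cong) simp
  also have "\<dots> = (\<Sum>z\<in>{z. length z = n}. \<integral>\<^sup>+ \<omega>. k z * indicator (cylinder z) \<omega> \<partial>path_measure p s)"
    by (intro nn_integral_sum borel_measurable_times_ennreal borel_measurable_const borel_measurable_indicator)
      (simp add: sets_path_measure)
  also have "\<dots> = (\<Sum>z\<in>{z. length z = n}. k z * ennreal (cylinder_prob p s z))"
    by (intro sum.cong)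
      (simp_all add: sets_path_measure nn_integral_cmult_indicator P.emeasure_eq_measure measure_path_measure)
  finally show ?thesis .
qed

lemma cylinder_prob_append:
  assumes "length s \<le> length z"
  shows "cylinder_prob p s (z @ [x]) = cylinder_prob p s z * pmf (p z) x"
proof -
  let ?f = "\<lambda>y i. pmf (if i < length s then return_pmf (s ! i) else p (take i y)) (y ! i)"
  have "(\<Prod>i<length z. ?f (z @ [x]) i) = (\<Prod>i<length z. ?f z i)"
    by (intro prod.cong) (auto simp: nth_append)
  then show ?thesis using assms by (simp add: cylinder_prob_prod[symmetric])
qed

lemma cylinder_prob_nonneg: "0 \<le> cylinder_prob p s z"
  unfolding cylinder_prob_prod[symmetric] by (intro prod_nonneg) auto

text \<open>
  The expectation of a supermartingale for the tree \<open>p\<close> at time \<open>n\<close> does not increase with \<open>n\<close>.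
\<close>

lemma nn_integral_prefix_of_le:
  fixes k :: "'x::finite situation \<Rightarrow> ennreal"
  assumes k: "\<And>z. (\<Sum>x\<in>UNIV. k (z @ [x]) * ennreal (pmf (p z) x)) \<le> k z"
    and "length s \<le> n"
  shows "(\<integral>\<^sup>+ \<omega>. k (prefix_of \<omega> n) \<partial>path_measure p s) \<le> k s"
  using assms(2)
proof (induction n rule: dec_induct)
  case base
  have fin: "finite {z :: 'x situation. length z = length s}"
    using finite_lists_length_eq[of "UNIV :: 'x set" "length s"] by simp
  have "(\<Sum>z\<in>{z. length z = length s}. k z * ennreal (cylinder_prob p s z))
     = (\<Sum>z\<in>{z. length z = length s}. if z = s then k z else 0)"
    by (intro sum.cong) (auto simp: cylinder_prob_def)
  also have "\<dots> = k s" using fin by simp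
  finally show ?case by (simp add: nn_integral_prefix_of)
next
  case (step n)
  let ?L = "{z :: 'x situation. length z = n}"
  have L: "{z :: 'x situation. length z = Suc n} = (\<lambda>(z, x). z @ [x]) ` (?L \<times> UNIV)"
    by (auto simp: image_iff length_Suc_conv_rev)
  have inj: "inj_on (\<lambda>(z, x). z @ [x]) (?L \<times> (UNIV :: 'x set))" by (auto simp: inj_on_def)
  have "(\<Sum>z\<in>{z. length z = Suc n}. k z * ennreal (cylinder_prob p s z))
      = (\<Sum>(z, x)\<in>?L \<times> UNIV. k (z @ [x]) * ennreal (cylinder_prob p s (z @ [x])))"
    unfolding L by (subst sum.reindex[OF inj]) (simp add: case_prod_beta')
  also have "\<dots> = (\<Sum>z\<in>?L. \<Sum>x\<in>UNIV. k (z @ [x]) * ennreal (cylinder_prob p s (z @ [x])))"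
    by (simp add: sum.cartesian_product)
  also have "\<dots> = (\<Sum>z\<in>?L. (\<Sum>x\<in>UNIV. k (z @ [x]) * ennreal (pmf (p z) x)) * ennreal (cylinder_prob p s z))"
    using step(1) by (intro sum.cong) (simp_all add: cylinder_prob_append ennreal_mult cylinder_prob_nonneg sum_distrib_left mult_ac)
  also have "\<dots> \<le> (\<Sum>z\<in>?L. k z * ennreal (cylinder_prob p s z))"
    by (intro sum_mono mult_right_mono k) simp
  also have "\<dots> \<le> k s" using step(3) by (simp add: nn_integral_prefix_of)
  finally show ?case by (simp add: nn_integral_prefix_of)
qed

text \<open>
  Membership in the credal set is tested on real functions only. If \<open>f\<close> is infinite with positive
  probability, arbitrarily large real functions concentrated at such a state show that the extension
  is infinite; otherwise the infinite values of \<open>f\<close> may be replaced by \<open>0\<close>.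
\<close>

lemma credal_set_le_upward_ext:
  fixes f :: "'x::finite \<Rightarrow> ereal"
  assumes q: "q \<in> credal_set Q s" and f: "\<And>x. 0 \<le> f x"
  shows "(\<Sum>x\<in>UNIV. e2ennreal (f x) * ennreal (pmf q x)) \<le> e2ennreal (upward_ext (Q s) f)"
proof (cases "\<exists>x. f x = \<infinity> \<and> pmf q x \<noteq> 0")
  case True
  then obtain x0 where x0: "f x0 = \<infinity>" "0 < pmf q x0" by (auto simp: less_le)
  have "ereal B \<le> upward_ext (Q s) f" for B
  proof -
    define g where "g x = (if x = x0 then B / pmf q x0 else 0)" for x
    have "ereal B = ereal (\<Sum>x\<in>UNIV. g x * pmf q x)"
    proof -
      have "(\<Sum>x\<in>UNIV. g x * pmf q x) = (\<Sum>x\<in>UNIV. if x = x0 then B else 0)"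
        using x0 by (intro sum.cong) (auto simp: g_def)
      then show ?thesis by simp
    qed
    also have "\<dots> \<le> Q s g" using q by (simp add: credal_set_def)
    also have "\<dots> \<le> upward_ext (Q s) f" by (rule upward_ext_upper) (use x0 f in \<open>simp add: g_def zero_ereal_def[symmetric]\<close>)
    finally show ?thesis .
  qed
  then have "upward_ext (Q s) f = \<infinity>" by (rule ereal_top)
  then show ?thesis by simp
next
  case False
  define g where "g x = real_of_ereal (f x)" for x
  have g: "0 \<le> g x" "ereal (g x) \<le> f x" for x
    using f[of x] unfolding g_def by (cases "f x"; simp)+
  have "e2ennreal (f x) * ennreal (pmf q x) = ennreal (g x * pmf q x)" for x
    using False f[of x] by (cases "f x") (auto simp: g_def ennreal_mult)
  then have "(\<Sum>x\<in>UNIV. e2ennreal (f x) * ennreal (pmf q x)) = ennreal (\<Sum>x\<in>UNIV. g x * pmf q x)"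
    using g(1) by (simp add: sum_ennreal)
  also have "\<dots> = e2ennreal (ereal (\<Sum>x\<in>UNIV. g x * pmf q x))" by simp
  also have "\<dots> \<le> e2ennreal (upward_ext (Q s) f)"
  proof (rule e2ennreal_mono)
    have "ereal (\<Sum>x\<in>UNIV. g x * pmf q x) \<le> Q s g" using q by (simp add: credal_set_def)
    also have "\<dots> \<le> upward_ext (Q s) f" by (rule upward_ext_upper) (rule g)
    finally show "ereal (\<Sum>x\<in>UNIV. g x * pmf q x) \<le> upward_ext (Q s) f" .
  qed
  finally show ?thesis .
qed

text \<open>
  Nonnegative integrals are available only after the shift by \<open>c\<close>. Integrating
  \<open>g\<^sup>+ + c = (g + c) + g\<^sup>-\<close> relates the shifted integral to the difference of the parts.
\<close>

lemma lebesgue_integral_ereal_le: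
  fixes g :: "'a \<Rightarrow> ereal"
  assumes "prob_space P" and g: "g \<in> borel_measurable P" "\<And>x. ereal (- c) \<le> g x" and c: "0 \<le> c" "- c \<le> m"
    and int: "(\<integral>\<^sup>+ x. e2ennreal (g x + ereal c) \<partial>P) \<le> ennreal (m + c)"
  shows "lebesgue_integral_ereal P g \<le> ereal m"
proof -
  interpret prob_space P by fact
  let ?p = "\<integral>\<^sup>+ x. e2ennreal (g x) \<partial>P" and ?n = "\<integral>\<^sup>+ x. e2ennreal (- g x) \<partial>P"
  have "e2ennreal (g x) + ennreal c = e2ennreal (g x + ereal c) + e2ennreal (- g x)" for x
  proof (cases "g x")
    case (real r)
    then show ?thesis using g(2)[of x] c
      by (cases "0 \<le> r") (auto simp: ennreal_neg simp flip: ennreal_plus)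
  qed (use g(2)[of x] in auto)
  then have "(\<integral>\<^sup>+ x. e2ennreal (g x) + ennreal c \<partial>P) = (\<integral>\<^sup>+ x. e2ennreal (g x + ereal c) + e2ennreal (- g x) \<partial>P)"
    by simp
  moreover have "(\<integral>\<^sup>+ x. e2ennreal (g x) + ennreal c \<partial>P) = ?p + ennreal c"
    using g(1) by (subst nn_integral_add) (auto simp: emeasure_space_1)
  ultimately have "?p + ennreal c = (\<integral>\<^sup>+ x. e2ennreal (g x + ereal c) + e2ennreal (- g x) \<partial>P)"
    by simp
  also have "\<dots> = (\<integral>\<^sup>+ x. e2ennreal (g x + ereal c) \<partial>P) + ?n"
    using g(1) by (intro nn_integral_add) auto
  also have "\<dots> \<le> ennreal (m + c) + ?n" using int by (rule add_right_mono)
  finally have le: "?p + ennreal c \<le> ennreal (m + c) + ?n" .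
  have "?n \<le> (\<integral>\<^sup>+ x. ennreal c \<partial>P)"
  proof (rule nn_integral_mono)
    fix x
    have "- g x \<le> ereal c" using g(2)[of x] by (cases "g x") auto
    then show "e2ennreal (- g x) \<le> ennreal c" using e2ennreal_mono by fastforce
  qed
  also have "\<dots> = ennreal c" by (simp add: emeasure_space_1)
  finally obtain n where n: "?n = ennreal n" "0 \<le> n" by (cases ?n) (auto simp: top_unique)
  then have "?p + ennreal c \<le> ennreal (m + c + n)" using le c by simp
  then obtain r where r: "?p = ennreal r" "0 \<le> r" by (cases ?p) (auto simp: top_unique)
  have "r - n \<le> m" using le n r c by (simp flip: ennreal_plus)
  then show ?thesis unfolding lebesgue_integral_ereal_def using n r by (simp add: enn2ereal_ennreal)
qed

context imprecise_tree begin

text \<open>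
  For compatible \<open>p\<close>, the lower limit of \<open>M\<close> on the cylinder of \<open>s\<close>, and \<open>\<infinity>\<close> elsewhere, is a
  measurable variable above \<open>f\<close>. The complement of the cylinder has probability zero, and by Fatou's
  lemma the integral is at most the lower limit of the expectations of \<open>M\<close> at time \<open>n\<close>, hence at most
  \<open>M s\<close>.
\<close>

lemma E_meas_le_EV: "E_meas Q f s \<le> EV f s"
proof (rule EV_greatest)
  fix M assume M: "bsuper M" "dominates M s f"
  show "E_meas Q f s \<le> M s"
    unfolding E_meas_def
  proof (rule Sup_least, elim CollectE exE conjE, hypsubst)
    fix p assume "compatible p Q"
    then have p: "p t \<in> credal_set Q t" for t by (simp add: compatible_def)
    interpret P: prob_space "path_measure p s" by (rule prob_space_path_measure)
    obtain c0 where c0: "\<And>t. ereal c0 \<le> M t" using bsuper_bound M by metis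
    define c where "c = \<bar>c0\<bar>"
    have c: "ereal (- c) \<le> M t" "0 \<le> c" for t
      using order_trans[OF _ c0[of t], of "ereal (- c)"] by (auto simp: c_def)
    define k where "k t = e2ennreal (M t + ereal c)" for t
    define g where "g \<omega> = (if \<omega> \<in> cylinder s then liminf (\<lambda>n. M (prefix_of \<omega> n)) else \<infinity>)" for \<omega>
    have g_ge: "ereal (- c) \<le> g \<omega>" for \<omega>
      unfolding g_def using c(1) by (auto intro!: Liminf_bounded always_eventually simp del: uminus_ereal.simps)
    have liminf_meas: "(\<lambda>\<omega>. liminf (\<lambda>n. M (prefix_of \<omega> n))) \<in> borel_measurable path_algebra"
      by (intro borel_measurable_liminf measurable_prefix_of) simp
    have g_meas: "g \<in> borel_measurable path_algebra"
      unfolding g_def by (intro measurable_If_set liminf_meas) auto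
    show "E_meas_precise p f s \<le> M s"
    proof (cases "M s = \<infinity>")
      case False
      then obtain m where m: "M s = ereal m" using c(1)[of s] by (cases "M s") auto
      have mc: "- c \<le> m" using c(1)[of s] m by simp
      have "E_meas_precise p f s \<le> lebesgue_integral_ereal (path_measure p s) g"
        unfolding E_meas_precise_def
      proof (intro Inf_lower CollectI exI[of _ g] conjI refl)
        show "bounded_below g" using g_ge unfolding bounded_below_def by blast
        show "g \<in> borel_measurable path_algebra" by (rule g_meas)
        show "\<forall>\<omega>. f \<omega> \<le> g \<omega>" using M(2) by (simp add: dominates_def g_def)
      qed
      also have "\<dots> \<le> ereal m"
      proof (rule lebesgue_integral_ereal_le[OF prob_space_path_measure _ g_ge c(2) mc])
        show "g \<in> borel_measurable (path_measure p s)"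
          using g_meas by (simp add: measurable_cong_sets[OF sets_path_measure refl])
        have "AE \<omega> in path_measure p s. \<omega> \<in> cylinder s"
          by (rule P.AE_prob_1) (simp add: measure_path_measure cylinder_prob_def)
        then have "(\<integral>\<^sup>+ \<omega>. e2ennreal (g \<omega> + ereal c) \<partial>path_measure p s)
          = (\<integral>\<^sup>+ \<omega>. liminf (\<lambda>n. k (prefix_of \<omega> n)) \<partial>path_measure p s)"
        proof (intro nn_integral_cong_AE, elim eventually_mono)
          fix \<omega> assume "\<omega> \<in> cylinder s"
          then have "e2ennreal (g \<omega> + ereal c) = e2ennreal (liminf (\<lambda>n. M (prefix_of \<omega> n) + ereal c))"
            by (simp add: g_def Liminf_add_ereal_right)
          also have "\<dots> = liminf (\<lambda>n. k (prefix_of \<omega> n))"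
            unfolding k_def
            by (rule Liminf_compose_continuous_mono[symmetric])
              (auto simp: continuous_on_e2ennreal mono_def e2ennreal_mono)
          finally show "e2ennreal (g \<omega> + ereal c) = liminf (\<lambda>n. k (prefix_of \<omega> n))" .
        qed
        also have "\<dots> \<le> liminf (\<lambda>n. \<integral>\<^sup>+ \<omega>. k (prefix_of \<omega> n) \<partial>path_measure p s)"
          by (rule nn_integral_liminf)
            (simp add: measurable_cong_sets[OF sets_path_measure refl] measurable_prefix_of)
        also have "\<dots> \<le> k s"
        proof (rule Liminf_le)
          have "(\<Sum>x\<in>UNIV. k (z @ [x]) * ennreal (pmf (p z) x)) \<le> k z" for z
          proof -
            have "0 \<le> M t + ereal c" for t using c(1)[of t] by (cases "M t") auto
            then have "(\<Sum>x\<in>UNIV. k (z @ [x]) * ennreal (pmf (p z) x))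
              \<le> e2ennreal (upward_ext (Q z) (\<lambda>x. M (z @ [x]) + ereal c))"
              unfolding k_def by (intro credal_set_le_upward_ext p)
            also have "\<dots> \<le> k z" unfolding k_def
              using bsuperD[OF bsuper_add[OF M(1) bsuper_const]] by (rule e2ennreal_mono)
            finally show ?thesis .
          qed
          then have "(\<integral>\<^sup>+ \<omega>. k (prefix_of \<omega> n) \<partial>path_measure p s) \<le> k s" if "length s \<le> n" for n
            using that by (rule nn_integral_prefix_of_le)
          then show "\<forall>\<^sub>F n in sequentially. (\<integral>\<^sup>+ \<omega>. k (prefix_of \<omega> n) \<partial>path_measure p s) \<le> k s"
            by (auto simp: eventually_sequentially)
        qed simp
        also have "k s = ennreal (m + c)" by (simp add: k_def m)
        finally show "(\<integral>\<^sup>+ \<omega>. e2ennreal (g \<omega> + ereal c) \<partial>path_measure p s) \<le> ennreal (m + c)" .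
      qed
      finally show ?thesis by (simp add: m)
    qed simp
  qed
qed

end

theorem corollary19:
  fixes Q :: "'x::finite local_models"
  assumes "imprecise_probability_tree Q"
  shows "\<forall>(f :: 'x global_variable) (s :: 'x situation).
    E_meas Q f s \<le> E_A Q f s \<and> E_A Q f s = E_V Q f s"
proof -
  interpret imprecise_tree Q by standard (rule assms)
  show ?thesis using E_meas_le_EV E_A_eq_E_V by simp
qed

end
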